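(* Let $E$ be a non-empty cohesive almost zero-dimensional space. Then there is a homeomorphic embedding $\alpha:E\hookrightarrow \mathfrak E_{\mathrm c}$ such that $\alpha(E)$ is dense in $\mathfrak E_{\mathrm c}$ and $\alpha(E)\cup\{\infty\}$ is connected (as a subspace of $\ell^2\cup\{\infty\}$).
   Context: All spaces are separable and metrizable. A subset $A$ of a space $X$ is a C-set in $X$ if $A$ is an intersection of clopen subsets of $X$. A space $X$ is almost zero-dimensional if every point of $X$ has a neighborhood basis consisting of C-sets in $X$. A space $X$ is cohesive if every point $x\in X$ has a neighborhood which contains no non-empty clopen subset of $X$. $\ell^2$ is the Hilbert space of square-summable real sequences with norm $\|\cdot\|$. Complete Erdős space is $\mathfrak E_{\mathrm c}=\{x\in\ell^2: x_i\in\{0\}\cup\{1/n:n=1,2,3,\dots\}\text{ for each } i<\omega\}$ with the $\ell^2$-norm topology. The space $\ell^2\cup\{\infty\}$ is obtained by adding a point $\infty$ whose neighborhoods are the complements (together with $\infty$) of norm-bounded subsets of $\ell^2$. *)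

theory Defs
  imports "HOL-Analysis.Analysis"
begin

definition l2 :: "(nat \<Rightarrow> real) set" where
  "l2 = {x. summable (\<lambda>i. (x i)\<^sup>2)}"

definition l2_norm :: "(nat \<Rightarrow> real) \<Rightarrow> real" where
  "l2_norm x = sqrt (\<Sum>i. (x i)\<^sup>2)"

definition l2_dist :: "(nat \<Rightarrow> real) \<Rightarrow> (nat \<Rightarrow> real) \<Rightarrow> real" where
  "l2_dist x y = l2_norm (\<lambda>i. x i - y i)"

definition l2_open :: "(nat \<Rightarrow> real) set \<Rightarrow> bool" where
  "l2_open U \<longleftrightarrow> U \<subseteq> l2 \<and>
     (\<forall>x\<in>U. \<exists>e>0. \<forall>y\<in>l2. l2_dist x y < e \<longrightarrow> y \<in> U)"

definition l2_topology :: "(nat \<Rightarrow> real) topology" where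
  "l2_topology = topology l2_open"

lemma istopology_l2_open: "istopology l2_open"
  unfolding istopology_def l2_open_def
proof (intro conjI allI impI)
  fix S T :: "(nat \<Rightarrow> real) set"
  assume S: "S \<subseteq> l2 \<and> (\<forall>x\<in>S. \<exists>e>0. \<forall>y\<in>l2. l2_dist x y < e \<longrightarrow> y \<in> S)"
     and T: "T \<subseteq> l2 \<and> (\<forall>x\<in>T. \<exists>e>0. \<forall>y\<in>l2. l2_dist x y < e \<longrightarrow> y \<in> T)"
  show "S \<inter> T \<subseteq> l2" using S by blast
  show "\<forall>x\<in>S \<inter> T. \<exists>e>0. \<forall>y\<in>l2. l2_dist x y < e \<longrightarrow> y \<in> S \<inter> T"
  proof
    fix x assume "x \<in> S \<inter> T"
    then obtain e1 e2 where "e1 > 0" "\<forall>y\<in>l2. l2_dist x y < e1 \<longrightarrow> y \<in> S"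
        "e2 > 0" "\<forall>y\<in>l2. l2_dist x y < e2 \<longrightarrow> y \<in> T" using S T by blast
    then show "\<exists>e>0. \<forall>y\<in>l2. l2_dist x y < e \<longrightarrow> y \<in> S \<inter> T"
      by (intro exI[of _ "min e1 e2"]) auto
  qed
next
  fix K :: "(nat \<Rightarrow> real) set set"
  assume K: "\<forall>S\<in>K. S \<subseteq> l2 \<and> (\<forall>x\<in>S. \<exists>e>0. \<forall>y\<in>l2. l2_dist x y < e \<longrightarrow> y \<in> S)"
  show "\<Union>K \<subseteq> l2" using K by blast
  show "\<forall>x\<in>\<Union>K. \<exists>e>0. \<forall>y\<in>l2. l2_dist x y < e \<longrightarrow> y \<in> \<Union>K"
  proof
    fix x assume "x \<in> \<Union>K"
    then obtain S where S: "S \<in> K" "x \<in> S" by blast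
    then obtain e where "e > 0" "\<forall>y\<in>l2. l2_dist x y < e \<longrightarrow> y \<in> S" using K by blast
    then show "\<exists>e>0. \<forall>y\<in>l2. l2_dist x y < e \<longrightarrow> y \<in> \<Union>K" using S(1) by blast
  qed
qed

definition erdos_c :: "(nat \<Rightarrow> real) set" where
  "erdos_c = {x \<in> l2. \<forall>i. x i \<in> {0} \<union> {1 / real n | n. n \<ge> 1}}"

definition erdos_c_topology :: "(nat \<Rightarrow> real) topology" where
  "erdos_c_topology = subtopology l2_topology erdos_c"

section \<open>l2 with a point at infinity; None plays the role of the point infinity\<close>

definition l2inf_open :: "(nat \<Rightarrow> real) option set \<Rightarrow> bool" where
  "l2inf_open U \<longleftrightarrow> U \<subseteq> Some ` l2 \<union> {None} \<and>
     l2_open {x. Some x \<in> U} \<and>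
     (None \<in> U \<longrightarrow> (\<exists>r. \<forall>x\<in>l2. r < l2_norm x \<longrightarrow> Some x \<in> U))"

definition l2inf_topology :: "(nat \<Rightarrow> real) option topology" where
  "l2inf_topology = topology l2inf_open"

definition clopenin :: "'a topology \<Rightarrow> 'a set \<Rightarrow> bool" where
  "clopenin X C \<longleftrightarrow> closedin X C \<and> openin X C"

text \<open>A is an intersection of clopen subsets of X (the empty intersection is the whole space).\<close>
definition C_set :: "'a topology \<Rightarrow> 'a set \<Rightarrow> bool" where
  "C_set X A \<longleftrightarrow> (\<exists>\<U>. (\<forall>U\<in>\<U>. clopenin X U) \<and> A = topspace X \<inter> \<Inter>\<U>)"

definition almost_zero_dimensional :: "'a topology \<Rightarrow> bool" where
  "almost_zero_dimensional X \<longleftrightarrow>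
     (\<forall>x\<in>topspace X. \<forall>U. openin X U \<and> x \<in> U \<longrightarrow>
        (\<exists>V C. openin X V \<and> x \<in> V \<and> V \<subseteq> C \<and> C \<subseteq> U \<and> C_set X C))"

definition cohesive :: "'a topology \<Rightarrow> bool" where
  "cohesive X \<longleftrightarrow>
     (\<forall>x\<in>topspace X. \<exists>N V. openin X V \<and> x \<in> V \<and> V \<subseteq> N \<and> N \<subseteq> topspace X \<and>
        (\<forall>C. clopenin X C \<and> C \<subseteq> N \<longrightarrow> C = {}))"

end

theory Submission
  imports Defs
begin

text \<open>
  A countable algebra of clopen sets yields a coarser zero-dimensional topology \<open>T\<close> on \<open>E\<close> in which
  every point has a base of \<open>T\<close>-closed neighbourhoods. A Urysohn construction gives continuous,
  \<open>T\<close>-lower semicontinuous functions, and a suitable sum \<open>f\<close> of them is unbounded on every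
  non-empty clopen set (by cohesion) and generates the topology of \<open>E\<close> together with \<open>T\<close>.
  The squared norm on complete Erdos space behaves in the same way over the coordinatewise topology.
  Call a function splitting if a clopen set can be cut in two so that the infimum stays
  the same on one half and is prescribed on the other, up to small errors. Both functions
  are splitting, so a back-and-forth argument matches finer and finer finite clopen partitions of the
  two spaces, with the differences of the infima converging uniformly. The limit is a map
  \<open>\<alpha>\<close> that is a homeomorphism onto its image for the coarse topologies, with dense image, such that
  \<open>f - \<parallel>\<alpha>\<parallel>\<^sup>2\<close> is continuous and bounded. So \<open>\<alpha>\<close> is a dense embedding whose norm is unbounded on every
  non-empty clopen set, which is what connectedness with the point at infinity means.
\<close>

section \<open>Witness topologies\<close>

text \<open>Why infima: for a function that is lower semicontinuous over the coarse topology, the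
  infima over pieces shrinking to a point increase to its value there, so a partition with the
  infima of its pieces is a finite approximation of the function. When a piece is cut, one half
  keeps the infimum and the other raises it by some b >= 0 that cannot be chosen. The partner must
  be cut with the same b, and splitting says that this is possible for every b; on the side of the
  cohesive space it holds because an unbounded \<open>f\<close> leaves no gaps in its values on a
  clopen set. Infima are prescribed only approximately, so stage n is allowed the error (1/2)^n, and
  the sum 2 of these errors bounds the drift of the differences. At the end one-sided control
  suffices: in both spaces a point near x in the coarse topology is near x in the fine one as soon
  as its value is not much larger. The pieces of the cohesive space are clopen in its own topology;
  they are tied to \<open>T\<close> by deciding, one after another, all sets of a base of
  \<open>T\<close>.\<close>

lemma metrizable_separable_imp_second_countable:
  assumes "metrizable_space X" and "separable_space X"
  shows "second_countable X"
proof -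
  obtain M d where "Metric_space M d" and X: "X = Metric_space.mtopology M d"
    using assms(1) unfolding metrizable_space_def by metis
  interpret Metric_space M d by fact
  obtain C where C: "countable C" "C \<subseteq> M" "mtopology closure_of C = M"
    using assms(2) unfolding X separable_space_def by auto
  define B where "B = (\<lambda>(c,n). mball c (1 / real (Suc n))) ` (C \<times> (UNIV :: nat set))"
  have "\<exists>V\<in>B. x \<in> V \<and> V \<subseteq> U" if U: "openin mtopology U" "x \<in> U" for U x
  proof -
    obtain r where r: "r > 0" "mball x r \<subseteq> U" and "x \<in> M"
      using U unfolding openin_mtopology by blast
    obtain n where n: "1 / real (Suc n) < r / 2"
      using nat_approx_posE[of "r / 2"] r(1) by auto
    have "x \<in> mtopology closure_of C"
      using C(3) \<open>x \<in> M\<close> by blast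
    then have "\<forall>r>0. \<exists>y\<in>C. y \<in> mball x r"
      unfolding metric_closure_of by blast
    moreover have "0 < 1 / real (Suc n)" by simp
    ultimately obtain c where c: "c \<in> C" "c \<in> mball x (1 / real (Suc n))"
      by blast
    have "x \<in> mball c (1 / real (Suc n))"
      using c by (simp add: commute)
    moreover have "mball c (1 / real (Suc n)) \<subseteq> mball x r"
    proof
      fix y assume "y \<in> mball c (1 / real (Suc n))"
      then show "y \<in> mball x r"
        using c n triangle[of x c y] by auto
    qed
    ultimately show ?thesis
      using c(1) r(2) by (auto simp: B_def intro!: bexI[of _ "(c, n)"])
  qed
  moreover have "countable B"
    using C(1) by (simp add: B_def)
  moreover have "\<forall>V\<in>B. openin mtopology V"
    by (auto simp: B_def)
  ultimately show ?thesis
    unfolding second_countable_def X by blast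
qed

text \<open>\<open>T\<close> records what the C-sets know about \<open>X\<close>:
  \<open>closed_nbhds\<close> is almost zero-dimensionality with C-sets replaced by
  \<open>T\<close>-closed sets. Zero-dimensionality of \<open>T\<close> takes the form of a
  countable clopen base \<open>Z\<close> because the members of \<open>Z\<close> are later
  enumerated and decided one by one. Second countability of \<open>X\<close> feeds the Lindelof
  argument in \<open>interpolation\<close> and the enumeration in
  \<open>bump_functions\<close>.\<close>

locale witness_topology =
  fixes X T :: "'a topology" and Z :: "'a set set"
  assumes topspace_eq: "topspace T = topspace X"
    and coarser: "openin T U \<Longrightarrow> openin X U"
    and second_countable: "second_countable X"
    and Z_countable: "countable Z"
    and Z_clopen: "A \<in> Z \<Longrightarrow> openin T A \<and> closedin T A"
    and Z_base: "openin T U \<Longrightarrow> x \<in> U \<Longrightarrow> \<exists>A\<in>Z. x \<in> A \<and> A \<subseteq> U"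
    and closed_nbhds: "openin X U \<Longrightarrow> x \<in> U \<Longrightarrow>
      \<exists>V C. openin X V \<and> closedin T C \<and> x \<in> V \<and> V \<subseteq> C \<and> C \<subseteq> U"
begin

lemma closedin_coarser: "closedin T C \<Longrightarrow> closedin X C"
  by (simp add: closedin_def coarser topspace_eq)

text \<open>The complement of \<open>A\<close> is a countable union of members of \<open>Z\<close>;
  removing them one at a time leaves clopen sets that shrink to \<open>A\<close>.\<close>

lemma closedin_decreasing:
  assumes "closedin T A"
  obtains D :: "nat \<Rightarrow> 'a set" where "\<And>n. closedin T (D n)" "\<And>n. openin T (D n)"
    "\<And>n. A \<subseteq> D n" "\<And>m n. m \<le> n \<Longrightarrow> D n \<subseteq> D m"
    "\<And>x. x \<in> topspace X - A \<Longrightarrow> \<exists>n. x \<notin> D n"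
proof -
  \<comment> \<open>The empty set is added so that there is something to enumerate when no member of
    \<open>Z\<close> misses \<open>A\<close>.\<close>
  define F where "F = insert {} {B \<in> Z. B \<inter> A = {}}"
  have F: "countable F" "F \<noteq> {}" and FA: "\<And>B. B \<in> F \<Longrightarrow> B \<inter> A = {} \<and> openin T B \<and> closedin T B"
    using Z_countable Z_clopen by (auto simp: F_def)
  define D where "D n = topspace X - (\<Union>i\<le>n. from_nat_into F i)" for n
  have *: "openin T (\<Union>i\<le>n. from_nat_into F i)" "closedin T (\<Union>i\<le>n. from_nat_into F i)" for n
    using FA from_nat_into[OF F(2)] by (auto intro!: closedin_Union)
  have "closedin T (D n)" "openin T (D n)" for n
    using * by (auto simp: D_def closedin_def topspace_eq[symmetric])
  moreover have "A \<subseteq> D n" for n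
    using FA from_nat_into[OF F(2)] closedin_subset[OF assms] by (force simp: D_def topspace_eq)
  moreover have "D n \<subseteq> D m" if "m \<le> n" for m n
    using that by (fastforce simp: D_def)
  moreover have "\<exists>n. x \<notin> D n" if x: "x \<in> topspace X - A" for x
  proof -
    have "openin T (topspace T - A)" using assms by blast
    then obtain B where "B \<in> Z" "x \<in> B" "B \<subseteq> topspace T - A"
      using Z_base[of "topspace T - A" x] x topspace_eq by auto
    then have "B \<in> F" by (auto simp: F_def)
    then obtain n where "from_nat_into F n = B"
      using F(1) from_nat_into_surj by metis
    then show ?thesis
      using \<open>x \<in> B\<close> by (auto simp: D_def)
  qed
  ultimately show ?thesis by (intro that[of D])
qed

text \<open>An infinite union of \<open>T\<close>-closed sets is rarely \<open>T\<close>-closed; cutting the \<open>i\<close>-th one down by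
  \<open>D i\<close>, where the sets \<open>D i\<close> are clopen and decrease to \<open>A\<close>, makes the union locally finite off \<open>A\<close>.\<close>

lemma interpolation:
  assumes A: "closedin T A" and U: "openin X U" and "A \<subseteq> U"
  shows "\<exists>G C. openin X G \<and> closedin T C \<and> A \<subseteq> G \<and> G \<subseteq> C \<and> C \<subseteq> U"
proof (cases "A = {}")
  case True
  then show ?thesis by (intro exI[of _ "{}"]) auto
next
  case False
  obtain V C where VC: "\<And>x. x \<in> A \<Longrightarrow> openin X (V x) \<and> closedin T (C x) \<and> x \<in> V x \<and> V x \<subseteq> C x \<and> C x \<subseteq> U"
    using closed_nbhds[OF U] \<open>A \<subseteq> U\<close> by (metis subsetD)
  have "Lindelof_space (subtopology X A)"
    using A closedin_coarser Lindelof_space_closedin_subtopology second_countable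
      second_countable_imp_Lindelof_space by blast
  then obtain W where W: "countable W" "W \<subseteq> V ` A" "A \<subseteq> \<Union>W"
    using VC closedin_subset[OF closedin_coarser[OF A]]
    by (subst (asm) Lindelof_space_subtopology_subset) (auto dest!: spec[of _ "V ` A"])
  obtain A' where A': "countable A'" "A' \<subseteq> A" "W = V ` A'"
    using countable_subset_image[of W V A] W by auto
  have "A' \<noteq> {}" using W(3) A'(3) False by blast
  define a where "a = from_nat_into A'"
  have range_a: "range a = A'"
    using A' \<open>A' \<noteq> {}\<close> by (simp add: a_def range_from_nat_into)
  then have aA: "a i \<in> A" for i using A' by auto
  obtain D :: "nat \<Rightarrow> 'a set" where D: "\<And>n. closedin T (D n)" "\<And>n. openin T (D n)"
    "\<And>n. A \<subseteq> D n" "\<And>m n. m \<le> n \<Longrightarrow> D n \<subseteq> D m"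
    "\<And>x. x \<in> topspace X - A \<Longrightarrow> \<exists>n. x \<notin> D n"
    using closedin_decreasing[OF A] by blast
  define G where "G = (\<Union>i. V (a i) \<inter> D i)"
  define K where "K = A \<union> (\<Union>i. C (a i) \<inter> D i)"
  have "openin X G"
    unfolding G_def using VC aA D(2) coarser by blast
  moreover have "A \<subseteq> G"
  proof
    fix x assume "x \<in> A"
    then obtain b where "b \<in> A'" "x \<in> V b" using W A' by blast
    then obtain i where "x \<in> V (a i)" using range_a by auto
    then show "x \<in> G" using D(3) \<open>x \<in> A\<close> by (auto simp: G_def)
  qed
  moreover have "G \<subseteq> K" "K \<subseteq> U"
    using VC aA \<open>A \<subseteq> U\<close> unfolding G_def K_def by blast+
  moreover have "closedin T K"
  proof -
    have "openin T (topspace T - K)"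
    proof (subst openin_subopen, intro ballI)
      fix x assume x: "x \<in> topspace T - K"
      then have "x \<in> topspace X - A" using topspace_eq by (auto simp: K_def)
      then obtain n where n: "x \<notin> D n" using D(5) by blast
      \<comment> \<open>Outside \<open>D n\<close> only \<open>A\<close> and the sets with index
        below \<open>n\<close> contribute to \<open>K\<close>, so a finite union of
        \<open>T\<close>-closed sets has to be removed.\<close>
      let ?N = "(topspace T - D n) - (A \<union> (\<Union>i\<in>{..<n}. C (a i) \<inter> D i))"
      have "closedin T (A \<union> (\<Union>i\<in>{..<n}. C (a i) \<inter> D i))"
        using VC aA D(1) A by (intro closedin_Un closedin_Union) auto
      then have "openin T ?N"
        using D(1) by (intro openin_diff) auto
      moreover have "x \<in> ?N" using x n by (auto simp: K_def)
      moreover have "?N \<subseteq> topspace T - K"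
      proof -
        have "i < n" if "y \<in> D i" "y \<notin> D n" for y i
          using D(4)[of n i] that by (meson linorder_not_le subsetD)
        then show ?thesis by (auto simp: K_def)
      qed
      ultimately show "\<exists>N. openin T N \<and> x \<in> N \<and> N \<subseteq> topspace T - K" by blast
    qed
    moreover have "K \<subseteq> topspace T"
      using VC aA closedin_subset A unfolding K_def by fast
    ultimately show ?thesis by (simp add: closedin_def)
  qed
  ultimately show ?thesis by blast
qed

text \<open>Urysohn's recursion over the dyadic rationals, with \<open>R\<close> (an
  \<open>X\<close>-open set fits between two \<open>T\<close>-closed sets) in place of "closure
  inside interior"; \<open>interpolation\<close> makes \<open>R\<close> dense. The intermediate open
  sets give upper semicontinuity for \<open>X\<close>, while the \<open>T\<close>-closed sets
  \<open>F r\<close> give lower semicontinuity already for \<open>T\<close>.\<close>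

lemma Urysohn_lower_semicontinuous:
  assumes A: "closedin T A" and U: "openin X U" and "A \<subseteq> U"
  obtains f :: "'a \<Rightarrow> real" where "continuous_map X euclideanreal f"
    "\<And>x. 0 \<le> f x \<and> f x \<le> 1" "\<And>x. x \<in> A \<Longrightarrow> f x = 0" "\<And>x. f x < 1 \<Longrightarrow> x \<in> U"
    "\<And>c. openin T {x \<in> topspace X. c < f x}"
proof -
  define R where "R = (\<lambda>C C'. closedin T C \<and> closedin T C' \<and> (\<exists>G. openin X G \<and> C \<subseteq> G \<and> G \<subseteq> C'))"
  obtain G0 C1 where 1: "openin X G0" "closedin T C1" "A \<subseteq> G0" "G0 \<subseteq> C1" "C1 \<subseteq> U"
    using interpolation[OF assms] by blast
  have "R A C1" using 1 A by (auto simp: R_def)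
  have step: "\<exists>z. R x z \<and> R z y" if xy: "R x y" for x y
  proof -
    obtain G where "openin X G" "x \<subseteq> G" "G \<subseteq> y" "closedin T x" "closedin T y"
      using xy by (auto simp: R_def)
    then show ?thesis
      using interpolation[of x G] by (auto simp: R_def)
  qed
  have trans: "R x z" if "R x y" "R y z" for x y z
    using that unfolding R_def by (meson subset_trans)
  define D where "D = (dyadics \<inter> {0..1} :: real set)"
  have "0 \<in> D" "1 \<in> D" and D01: "\<And>r. r \<in> D \<Longrightarrow> 0 \<le> r \<and> r \<le> 1"
    using real_in_dyadics[of 0] real_in_dyadics[of 1] by (auto simp: D_def)
  have dense: "\<exists>d\<in>D. a < d \<and> d < b" if ab: "0 \<le> a" "a < b" "b \<le> 1" for a b
  proof -
    obtain n q r where "real q / 2^n \<le> a" "a < real r / 2^n" "\<bar>real q / 2^n - real r / 2^n\<bar> < b - a"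
      using padic_rational_approximation_straddle_pos_le[of "b - a" 2 a] ab
      by (metis diff_gt_0_iff_gt one_less_numeral_iff semiring_norm(76))
    moreover define d where "d = real r / 2^n"
    ultimately have d: "a < d" "d < b" by auto
    have "d \<in> dyadics" unfolding dyadics_def d_def by blast
    then have "d \<in> D" using ab d by (simp add: D_def)
    then show ?thesis using d by blast
  qed
  have "\<exists>F :: real \<Rightarrow> 'a set. F 0 = A \<and> F 1 = C1 \<and> (\<forall>x\<in>D. \<forall>y\<in>D. x < y \<longrightarrow> R (F x) (F y))"
    unfolding D_def by (rule recursion_on_dyadic_fractions) (fact \<open>R A C1\<close>, erule step, erule (1) trans)
  then obtain F :: "real \<Rightarrow> 'a set" where F0: "F 0 = A" and F1: "F 1 = C1" and
    FR: "\<And>x y. x \<in> D \<Longrightarrow> y \<in> D \<Longrightarrow> x < y \<Longrightarrow> R (F x) (F y)"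
    by (elim exE conjE) blast
  have F_mono: "F x \<subseteq> F y" if "x \<in> D" "y \<in> D" "x \<le> y" for x y
    using FR[of x y] that by (cases "x = y") (auto simp: R_def)
  have F_closed: "closedin T (F x)" if "x \<in> D" for x
    using FR[of x 1] that \<open>1 \<in> D\<close> D01[of x] 1(2) F1 by (cases "x = 1") (auto simp: R_def)
  \<comment> \<open>The added 1 is the value at points outside every \<open>F r\<close>; it keeps
    the infimum from ranging over the empty set.\<close>
  define f where "f x = Inf (insert 1 {r \<in> D. x \<in> F r})" for x
  have bdd: "bdd_below (insert 1 {r \<in> D. x \<in> F r})" for x
    using D01 by (auto intro!: bdd_belowI[of _ 0])
  have f01: "0 \<le> f x \<and> f x \<le> 1" for x
    unfolding f_def using bdd D01 by (auto intro!: cInf_greatest cInf_lower)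
  have f_less: "f x < c \<longleftrightarrow> 1 < c \<or> (\<exists>r\<in>D. x \<in> F r \<and> r < c)" for x c
    unfolding f_def by (subst cInf_less_iff) (use bdd in auto)
  have f_le: "f x \<le> r" if "r \<in> D" "x \<in> F r" for x r
    unfolding f_def using bdd that by (auto intro!: cInf_lower)
  have open_less: "openin X {x \<in> topspace X. f x < c}" for c
  proof (cases "c > 1")
    case True
    then have "{x \<in> topspace X. f x < c} = topspace X" using f01 by (auto intro: le_less_trans)
    then show ?thesis by simp
  next
    case False
    show ?thesis
    proof (subst openin_subopen, intro ballI)
      fix x assume "x \<in> {x \<in> topspace X. f x < c}"
      then obtain r where r: "r \<in> D" "x \<in> F r" "r < c" using f_less False by auto
      then obtain s where s: "s \<in> D" "r < s" "s < c" using dense[of r c] D01 False by auto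
      then obtain G where "openin X G" "F r \<subseteq> G" "G \<subseteq> F s"
        using FR[of r s] r by (auto simp: R_def)
      moreover have "F s \<subseteq> {x. f x < c}" using f_le s by fastforce
      ultimately show "\<exists>N. openin X N \<and> x \<in> N \<and> N \<subseteq> {x \<in> topspace X. f x < c}"
        using r openin_subset[of X G] by (intro exI[of _ G]) blast
    qed
  qed
  have lsc: "openin T {x \<in> topspace X. c < f x}" for c
  proof (cases "c < 0")
    case True
    then have "{x \<in> topspace X. c < f x} = topspace T"
      using f01 topspace_eq by (auto intro: less_le_trans)
    then show ?thesis by simp
  next
    case False
    show ?thesis
    proof (subst openin_subopen, intro ballI)
      fix x assume "x \<in> {x \<in> topspace X. c < f x}"
      then have x: "x \<in> topspace X" "c < f x" by auto
      then obtain r where r: "r \<in> D" "c < r" "r < f x" using dense[of c "f x"] False f01 by auto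
      have "x \<notin> F r" using f_le r by fastforce
      moreover have "c < f y" if "y \<notin> F r" for y
      proof (rule ccontr)
        assume "\<not> c < f y"
        then obtain s where "s \<in> D" "y \<in> F s" "s < r" using f_less[of y r] r D01[of r] by auto
        then show False using F_mono[of s r] r that by auto
      qed
      moreover have "openin T (topspace T - F r)" using F_closed r by blast
      ultimately show "\<exists>N. openin T N \<and> x \<in> N \<and> N \<subseteq> {x \<in> topspace X. c < f x}"
        using x topspace_eq by (intro exI[of _ "topspace T - F r"]) auto
    qed
  qed
  have "continuous_map X euclideanreal f"
    unfolding continuous_map_upper_lower_semicontinuous_lt
    using open_less coarser[OF lsc] by auto
  moreover have "f x = 0" if "x \<in> A" for x
    using f_le[of 0 x] \<open>0 \<in> D\<close> F0 that f01[of x] by auto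
  moreover have "x \<in> U" if fx: "f x < 1" for x
  proof -
    obtain r where "r \<in> D" "x \<in> F r" using fx f_less by auto
    then have "x \<in> F 1" using F_mono[of r 1] \<open>1 \<in> D\<close> D01 by blast
    then show ?thesis using F1 1 by blast
  qed
  ultimately show ?thesis
    using f01 lsc by (intro that[of f])
qed

end

section \<open>From C-sets to a witness topology\<close>

lemma clopenin_Int: "clopenin X A \<Longrightarrow> clopenin X B \<Longrightarrow> clopenin X (A \<inter> B)"
  by (auto simp: clopenin_def)

lemma clopenin_Diff: "clopenin X A \<Longrightarrow> clopenin X B \<Longrightarrow> clopenin X (A - B)"
  by (auto simp: clopenin_def closedin_diff openin_diff)

lemma closedin_topspace_Int_Inter:
  "(\<And>S. S \<in> F \<Longrightarrow> closedin X S) \<Longrightarrow> closedin X (topspace X \<inter> \<Inter>F)"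
  using closedin_Inter[of "insert (topspace X) F" X] by auto

text \<open>The complement of \<open>U\<close> is Lindelof and is covered by the complements of the
  clopen sets that define the C-set, so countably many of them suffice. Their intersection may be
  larger than \<open>C\<close> but still lies inside \<open>U\<close>.\<close>

lemma C_set_countable_intersection:
  assumes "second_countable X" and "C_set X C" and "openin X U" and "C \<subseteq> U"
  shows "\<exists>W. countable W \<and> (\<forall>A\<in>W. clopenin X A \<and> C \<subseteq> A) \<and> topspace X \<inter> \<Inter>W \<subseteq> U"
proof -
  obtain F where F: "\<And>A. A \<in> F \<Longrightarrow> clopenin X A" "C = topspace X \<inter> \<Inter>F"
    using assms(2) unfolding C_set_def by auto
  have FC: "C \<subseteq> A" if "A \<in> F" for A
    using F that by auto
  have "Lindelof_space (subtopology X (topspace X - U))"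
    using assms(1,3) Lindelof_space_closedin_subtopology second_countable_imp_Lindelof_space by blast
  moreover have "\<forall>B\<in>(\<lambda>A. topspace X - A) ` F. openin X B"
    using F(1) by (auto simp: clopenin_def)
  moreover have "topspace X - U \<subseteq> \<Union>((\<lambda>A. topspace X - A) ` F)"
    using F(2) assms(4) by auto
  ultimately obtain G where G: "countable G" "G \<subseteq> (\<lambda>A. topspace X - A) ` F" "topspace X - U \<subseteq> \<Union>G"
    using Lindelof_space_subtopology_subset[of "topspace X - U" X] by (metis Diff_subset)
  then obtain W where W: "countable W" "W \<subseteq> F" "G = (\<lambda>A. topspace X - A) ` W"
    using countable_subset_image[of G] by metis
  have "topspace X \<inter> \<Inter>W \<subseteq> U"
    using G(3) unfolding W(3) by auto
  moreover have "\<forall>A\<in>W. clopenin X A \<and> C \<subseteq> A"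
    using W(2) F(1) FC by blast
  ultimately show ?thesis
    using W(1) by (intro exI[of _ W]) simp
qed

text \<open>\<open>T\<close> is generated by countably many clopen sets: for each pair of basic open
  sets with a C-set between them, a countable family whose intersection also lies between them. That
  intersection, rather than the C-set, becomes the \<open>T\<close>-closed neighbourhood.
  Complements join the generators so that all of them are clopen in \<open>T\<close>.\<close>

lemma almost_zero_dimensional_witness:
  assumes sc: "second_countable X" and azd: "almost_zero_dimensional X"
  obtains T Z where "witness_topology X T Z"
proof -
  obtain B where B: "countable B" "\<And>V. V \<in> B \<Longrightarrow> openin X V"
    "\<And>U x. openin X U \<Longrightarrow> x \<in> U \<Longrightarrow> \<exists>V\<in>B. x \<in> V \<and> V \<subseteq> U"
    using sc unfolding second_countable_def by metis
  define P where "P = {(V, U). V \<in> B \<and> U \<in> B \<and> (\<exists>C. C_set X C \<and> V \<subseteq> C \<and> C \<subseteq> U)}"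
  have "P \<subseteq> B \<times> B" by (auto simp: P_def)
  then have "countable P" using B(1) by (meson countable_SIGMA countable_subset)
  have "\<exists>W. countable W \<and> (\<forall>A\<in>W. clopenin X A \<and> V \<subseteq> A) \<and> topspace X \<inter> \<Inter>W \<subseteq> U"
    if VU: "(V, U) \<in> P" for V U
  proof -
    obtain C where C: "C_set X C" "V \<subseteq> C" "C \<subseteq> U" "openin X U"
      using VU B(2) by (auto simp: P_def)
    obtain W where W: "countable W" "\<forall>A\<in>W. clopenin X A \<and> C \<subseteq> A" "topspace X \<inter> \<Inter>W \<subseteq> U"
      using C_set_countable_intersection[OF sc C(1,4,3)] by (elim exE conjE)
    have "clopenin X A \<and> V \<subseteq> A" if "A \<in> W" for A
      using W(2) that C(2) by blast
    then show ?thesis using W(1,3) by (intro exI[of _ W]) simp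
  qed
  then have "\<forall>p\<in>P. \<exists>W. countable W \<and> (\<forall>A\<in>W. clopenin X A \<and> fst p \<subseteq> A) \<and> topspace X \<inter> \<Inter>W \<subseteq> snd p"
    by fastforce
  then obtain W where "\<forall>p\<in>P. countable (W p) \<and> (\<forall>A\<in>W p. clopenin X A \<and> fst p \<subseteq> A) \<and> topspace X \<inter> \<Inter>(W p) \<subseteq> snd p"
    by (rule bchoice[THEN exE])
  then have W: "\<And>p. p \<in> P \<Longrightarrow> countable (W p)"
    "\<And>p A. p \<in> P \<Longrightarrow> A \<in> W p \<Longrightarrow> clopenin X A \<and> fst p \<subseteq> A"
    "\<And>p. p \<in> P \<Longrightarrow> topspace X \<inter> \<Inter>(W p) \<subseteq> snd p"
    by blast+
  define G where "G = (\<Union>p\<in>P. W p \<union> (\<lambda>A. topspace X - A) ` W p)"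
  have "countable G"
    unfolding G_def using W(1) \<open>countable P\<close> by auto
  have G: "clopenin X A \<and> topspace X - A \<in> G" if A: "A \<in> G" for A
  proof -
    obtain p where p: "p \<in> P" "A \<in> W p \<or> A \<in> (\<lambda>A. topspace X - A) ` W p"
      using A by (auto simp: G_def)
    then obtain B where "B \<in> W p" "A = B \<or> A = topspace X - B" by auto
    moreover have "topspace X - (topspace X - B) = B"
      using W(2)[of p B] p \<open>B \<in> W p\<close> closedin_subset by (fastforce simp: clopenin_def)
    ultimately show ?thesis
      using p W(2)[of p B] by (auto simp: G_def clopenin_def intro!: bexI[of _ p])
  qed
  \<comment> \<open>Intersecting with \<open>topspace X\<close> gives the empty family the right
    value, so that the whole space belongs to \<open>Z\<close>.\<close>
  define Z where "Z = (\<lambda>F. topspace X \<inter> \<Inter>F) ` {F. finite F \<and> F \<subseteq> G}"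
  have Z_Int: "S \<inter> S' \<in> Z" if S: "S \<in> Z" "S' \<in> Z" for S S'
  proof -
    obtain F F' where "finite F" "F \<subseteq> G" "S = topspace X \<inter> \<Inter>F" "finite F'" "F' \<subseteq> G" "S' = topspace X \<inter> \<Inter>F'"
      using S by (auto simp: Z_def)
    then show ?thesis
      unfolding Z_def by (intro image_eqI[of _ _ "F \<union> F'"]) auto
  qed
  define T where "T = topology (arbitrary union_of (\<lambda>S. S \<in> Z))"
  have openT: "openin T = arbitrary union_of (\<lambda>S. S \<in> Z)"
    unfolding T_def by (rule topology_inverse', rule istopology_base) (rule Z_Int)
  have ZT: "openin T S" if "S \<in> Z" for S
    using that by (simp add: openT arbitrary_union_of_inc)
  have Z_clopenX: "clopenin X S" if "S \<in> Z" for S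
    using that G by (auto simp: Z_def clopenin_def intro!: closedin_topspace_Int_Inter openin_Int_Inter)
  have coarse: "openin X U" if "openin T U" for U
    using that Z_clopenX unfolding openT union_of_def arbitrary_def
    by (auto simp: clopenin_def)
  have "topspace X \<in> Z" by (auto simp: Z_def intro!: image_eqI[of _ _ "{}"])
  then have top: "topspace T = topspace X"
    using coarse ZT openin_subset by (meson openin_topspace subset_antisym)
  have GZ: "A \<in> Z" if "A \<in> G" for A
    using that G[OF that] closedin_subset[of X A] by (auto simp: Z_def clopenin_def intro!: image_eqI[of _ _ "{A}"])
  have GT: "closedin T A" if "A \<in> G" for A
    using that G[OF that] closedin_subset[of X A] ZT[OF GZ] by (auto simp: closedin_def top clopenin_def)
  have "witness_topology X T Z"
  proof
    show "countable Z"
      unfolding Z_def by (intro countable_image countable_Collect_finite_subset \<open>countable G\<close>)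
    show "openin T A \<and> closedin T A" if "A \<in> Z" for A
      using ZT that GT by (auto simp: Z_def top[symmetric] intro!: closedin_topspace_Int_Inter)
    show "\<exists>A\<in>Z. x \<in> A \<and> A \<subseteq> U" if "openin T U" "x \<in> U" for U x
      using that unfolding openT union_of_def arbitrary_def by auto
    show "\<exists>V C. openin X V \<and> closedin T C \<and> x \<in> V \<and> V \<subseteq> C \<and> C \<subseteq> U" if U: "openin X U" "x \<in> U" for U x
    proof -
      obtain U' where U': "U' \<in> B" "x \<in> U'" "U' \<subseteq> U" using B(3) U by blast
      have "x \<in> topspace X" using U openin_subset by blast
      then obtain V' C where VC: "openin X V'" "x \<in> V'" "V' \<subseteq> C" "C \<subseteq> U'" "C_set X C"
        using azd B(2)[OF U'(1)] U'(2) unfolding almost_zero_dimensional_def by metis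
      obtain V where V: "V \<in> B" "x \<in> V" "V \<subseteq> V'" using B(3) VC by blast
      have p: "(V, U') \<in> P" using V VC U' by (auto simp: P_def)
      have "closedin T (topspace T \<inter> \<Inter>(W (V, U')))"
        using p GT by (intro closedin_topspace_Int_Inter) (auto simp: G_def)
      moreover have "V \<subseteq> topspace T \<inter> \<Inter>(W (V, U'))"
        using W(2)[OF p] B(2)[OF V(1)] openin_subset[of X V] top by auto
      moreover have "topspace T \<inter> \<Inter>(W (V, U')) \<subseteq> U"
        using W(3)[OF p] U' top by auto
      ultimately show ?thesis
        using V(2) B(2)[OF V(1)] by blast
    qed
  qed (use top coarse sc in auto)
  then show ?thesis by (rule that)
qed

section \<open>Lower semicontinuous functions and an unbounded potential\<close>

context witness_topology
begin

definition lsc :: "('a \<Rightarrow> real) \<Rightarrow> bool" where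
  "lsc f \<longleftrightarrow> (\<forall>c. openin T {x \<in> topspace X. c < f x})"

lemma lsc_add:
  assumes "lsc f" "lsc g"
  shows "lsc (\<lambda>x. f x + g x)"
  unfolding lsc_def
proof
  fix c
  have "{x \<in> topspace X. c < f x + g x} =
    (\<Union>r. {x \<in> topspace X. r < f x} \<inter> {x \<in> topspace X. c - r < g x})" (is "?L = ?R")
  proof
    show "?L \<subseteq> ?R"
    proof
      fix x assume x: "x \<in> ?L"
      define r where "r = (c - g x + f x) / 2"
      have "r < f x" "c - r < g x" using x by (auto simp: r_def field_simps)
      then show "x \<in> ?R" using x by blast
    qed
  qed auto
  then show "openin T ?L"
    using assms by (auto simp: lsc_def intro!: openin_Union openin_Int)
qed

lemma lsc_sum:
  assumes "\<And>i. i \<in> I \<Longrightarrow> lsc (f i)"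
  shows "lsc (\<lambda>x. \<Sum>i\<in>I. f i x)"
proof -
  have "lsc (\<lambda>x. 0)"
    unfolding lsc_def
  proof
    show "openin T {x \<in> topspace X. c < 0}" for c :: real
      using openin_topspace[of T] by (cases "c < 0") (simp_all add: topspace_eq)
  qed
  then show ?thesis
    using assms by (induction I rule: infinite_finite_induct) (auto intro!: lsc_add)
qed

text \<open>With non-negative terms the sum is the supremum of its partial sums, and suprema
  preserve lower semicontinuity.\<close>

lemma lsc_suminf:
  assumes "\<And>n. lsc (f n)" and "\<And>n x. 0 \<le> f n x" and "\<And>x. x \<in> topspace X \<Longrightarrow> summable (\<lambda>n. f n x)"
  shows "lsc (\<lambda>x. \<Sum>n. f n x)"
  unfolding lsc_def
proof
  fix c
  have "c < (\<Sum>n. f n x) \<longleftrightarrow> (\<exists>N. c < (\<Sum>n<N. f n x))" if x: "x \<in> topspace X" for x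
  proof
    assume "c < (\<Sum>n. f n x)"
    then have "\<forall>\<^sub>F N in sequentially. c < (\<Sum>n<N. f n x)"
      by (rule order_tendstoD(1)[OF summable_LIMSEQ[OF assms(3)[OF x]]])
    then show "\<exists>N. c < (\<Sum>n<N. f n x)"
      unfolding eventually_sequentially by blast
  next
    assume "\<exists>N. c < (\<Sum>n<N. f n x)"
    then show "c < (\<Sum>n. f n x)"
      using sum_le_suminf[OF assms(3)[OF x], of "{..<_}"] assms(2) by (meson finite_lessThan less_le_trans)
  qed
  then have "{x \<in> topspace X. c < (\<Sum>n. f n x)} = (\<Union>N. {x \<in> topspace X. c < (\<Sum>n<N. f n x)})"
    by auto
  moreover have "openin T {x \<in> topspace X. c < (\<Sum>n<N. f n x)}" for N
    using lsc_sum[of "{..<N}" f] assms(1) by (simp add: lsc_def)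
  ultimately show "openin T {x \<in> topspace X. c < (\<Sum>n. f n x)}"
    by auto
qed

text \<open>Cohesion enters here: the outer sets \<open>U n\<close> are basic open sets without
  non-empty clopen subsets, and \<open>\<phi> n\<close> is 1 off \<open>U n\<close>, so no non-empty
  clopen set lies where \<open>\<phi> n\<close> is below 1. The pairs \<open>(V n, U n)\<close> run
  through all such pairs of basic sets with a \<open>T\<close>-closed set in between, which is
  enough for the functions to recover the topology of \<open>X\<close>.\<close>

lemma bump_functions:
  assumes "cohesive X" and "topspace X \<noteq> {}"
  obtains \<phi> :: "nat \<Rightarrow> 'a \<Rightarrow> real" and V U :: "nat \<Rightarrow> 'a set" where
    "\<And>n. continuous_map X euclideanreal (\<phi> n)" "\<And>n. lsc (\<phi> n)" "\<And>n x. 0 \<le> \<phi> n x \<and> \<phi> n x \<le> 1"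
    "\<And>n. openin X (V n)" "\<And>n x. x \<in> V n \<Longrightarrow> \<phi> n x = 0" "\<And>n x. \<phi> n x < 1 \<Longrightarrow> x \<in> U n"
    "\<And>n C. clopenin X C \<Longrightarrow> C \<subseteq> U n \<Longrightarrow> C = {}"
    "\<And>W x. openin X W \<Longrightarrow> x \<in> W \<Longrightarrow> \<exists>n. x \<in> V n \<and> U n \<subseteq> W"
proof -
  obtain B where B: "countable B" "\<And>V. V \<in> B \<Longrightarrow> openin X V"
    "\<And>U x. openin X U \<Longrightarrow> x \<in> U \<Longrightarrow> \<exists>V\<in>B. x \<in> V \<and> V \<subseteq> U"
    using second_countable unfolding second_countable_def by metis
  define I where "I = {(V, U). V \<in> B \<and> U \<in> B \<and> (\<exists>C. closedin T C \<and> V \<subseteq> C \<and> C \<subseteq> U) \<and>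
    (\<forall>C. clopenin X C \<and> C \<subseteq> U \<longrightarrow> C = {})}"
  have I_base: "\<exists>V U. (V, U) \<in> I \<and> x \<in> V \<and> U \<subseteq> W" if W: "openin X W" "x \<in> W" for W x
  proof -
    have "x \<in> topspace X" using W openin_subset by blast
    then obtain N O' where N: "openin X O'" "x \<in> O'" "O' \<subseteq> N" "\<forall>C. clopenin X C \<and> C \<subseteq> N \<longrightarrow> C = {}"
      using assms(1) unfolding cohesive_def by meson
    have "openin X (W \<inter> O')" "x \<in> W \<inter> O'" using W N by auto
    then obtain U where U: "U \<in> B" "x \<in> U" "U \<subseteq> W \<inter> O'"
      using B(3) by meson
    obtain V' C where C: "openin X V'" "closedin T C" "x \<in> V'" "V' \<subseteq> C" "C \<subseteq> U"
      using closed_nbhds[OF B(2)[OF U(1)] U(2)] by (elim exE conjE)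
    obtain V where V: "V \<in> B" "x \<in> V" "V \<subseteq> V'" using B(3)[OF C(1,3)] by (elim bexE conjE)
    have "\<forall>C. clopenin X C \<and> C \<subseteq> U \<longrightarrow> C = {}"
      using N(3,4) U(3) by (meson le_inf_iff subset_trans)
    moreover have "\<exists>C. closedin T C \<and> V \<subseteq> C \<and> C \<subseteq> U" using C V by (meson subset_trans)
    ultimately have "(V, U) \<in> I" using V U by (simp add: I_def)
    then show ?thesis using V U by auto
  qed
  have "I \<subseteq> B \<times> B" by (auto simp: I_def)
  then have "countable I" using B(1) by (meson countable_SIGMA countable_subset)
  obtain x0 where "x0 \<in> topspace X" using assms(2) by blast
  then have "I \<noteq> {}" using I_base[of "topspace X" x0] by auto
  define p where "p = from_nat_into I"
  have pI: "p n \<in> I" for n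
    unfolding p_def using \<open>I \<noteq> {}\<close> by (rule from_nat_into)
  have "\<exists>f. continuous_map X euclideanreal f \<and> lsc f \<and> (\<forall>x. 0 \<le> f x \<and> f x \<le> 1) \<and>
    (\<forall>x\<in>fst (p n). f x = 0) \<and> (\<forall>x. f x < 1 \<longrightarrow> x \<in> snd (p n))" for n
  proof -
    obtain C where C: "closedin T C" "fst (p n) \<subseteq> C" "C \<subseteq> snd (p n)" "openin X (snd (p n))"
      using pI[of n] B(2) by (auto simp: I_def)
    obtain f where "continuous_map X euclideanreal f"
      "\<And>x. 0 \<le> f x \<and> f x \<le> 1" "\<And>x. x \<in> C \<Longrightarrow> f x = 0" "\<And>x. f x < 1 \<Longrightarrow> x \<in> snd (p n)"
      "\<And>c. openin T {x \<in> topspace X. c < f x}"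
      using Urysohn_lower_semicontinuous[OF C(1,4,3)] by blast
    then show ?thesis using C(2) by (intro exI[of _ f]) (auto simp: lsc_def)
  qed
  then obtain \<phi> where \<phi>: "\<forall>n. continuous_map X euclideanreal (\<phi> n) \<and> lsc (\<phi> n) \<and> (\<forall>x. 0 \<le> \<phi> n x \<and> \<phi> n x \<le> 1) \<and>
    (\<forall>x\<in>fst (p n). \<phi> n x = 0) \<and> (\<forall>x. \<phi> n x < 1 \<longrightarrow> x \<in> snd (p n))"
    by metis
  show ?thesis
  proof (rule that[of \<phi> "\<lambda>n. fst (p n)" "\<lambda>n. snd (p n)"])
    show "openin X (fst (p n))" for n
      using pI[of n] B(2) by (auto simp: I_def)
    show "C = {}" if "clopenin X C" "C \<subseteq> snd (p n)" for n C
      using pI[of n] that by (auto simp: I_def)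
    show "\<exists>n. x \<in> fst (p n) \<and> snd (p n) \<subseteq> W" if W: "openin X W" "x \<in> W" for W x
    proof -
      obtain V U where VU: "(V, U) \<in> I" "x \<in> V" "U \<subseteq> W" using I_base[OF W] by blast
      then obtain n where "p n = (V, U)"
        unfolding p_def using from_nat_into_surj[OF \<open>countable I\<close>] by metis
      then show ?thesis using VU by (intro exI[of _ n]) simp
    qed
  qed (use \<phi> in auto)
qed

end

lemma less_Min_image_iff:
  fixes g :: "nat \<Rightarrow> real"
  shows "c < Min (g ` {..n}) \<longleftrightarrow> (\<forall>j\<le>n. c < g j)" "Min (g ` {..n}) < c \<longleftrightarrow> (\<exists>j\<le>n. g j < c)"
  by (auto simp: Min_less_iff)

context witness_topology
begin

text \<open>A point outside the last set lies in a clopen set missing it, which cuts a clopen subset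
  of the union down to a clopen subset of the union of the other sets.\<close>

lemma no_clopen_in_finite_union:
  fixes \<phi> :: "nat \<Rightarrow> 'a \<Rightarrow> real"
  assumes "\<And>n. lsc (\<phi> n)" and "\<And>n C. clopenin X C \<Longrightarrow> C \<subseteq> {x. \<phi> n x \<le> c} \<Longrightarrow> C = {}"
  shows "clopenin X C \<Longrightarrow> C \<subseteq> (\<Union>j<n. {x. \<phi> j x \<le> c}) \<Longrightarrow> C = {}"
proof (induction n arbitrary: C)
  case 0
  then show ?case by simp
next
  case (Suc n)
  have "x \<notin> C" if x: "c < \<phi> n x" for x
  proof
    assume "x \<in> C"
    then have "x \<in> topspace X"
      using Suc.prems(1) openin_subset by (fastforce simp: clopenin_def)
    then obtain A where A: "A \<in> Z" "x \<in> A" "A \<subseteq> {x \<in> topspace X. c < \<phi> n x}"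
      using Z_base[of "{x \<in> topspace X. c < \<phi> n x}" x] assms(1)[of n] x unfolding lsc_def by blast
    have "clopenin X A"
      using Z_clopen[OF A(1)] coarser closedin_coarser by (simp add: clopenin_def)
    then have "clopenin X (C \<inter> A)"
      using Suc.prems(1) by (rule clopenin_Int[rotated])
    moreover have "C \<inter> A \<subseteq> (\<Union>j<n. {x. \<phi> j x \<le> c})"
    proof
      fix y assume y: "y \<in> C \<inter> A"
      then obtain j where "j < Suc n" "\<phi> j y \<le> c" using Suc.prems(2) by blast
      moreover have "c < \<phi> n y" using y A(3) by blast
      ultimately show "y \<in> (\<Union>j<n. {x. \<phi> j x \<le> c})" by (auto simp: less_Suc_eq)
    qed
    ultimately have "C \<inter> A = {}" by (rule Suc.IH)
    then show False using \<open>x \<in> C\<close> A(2) by blast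
  qed
  then have "C \<subseteq> {x. \<phi> n x \<le> c}" by (auto simp: not_less[symmetric])
  then show ?case by (rule assms(2)[OF Suc.prems(1)])
qed

text \<open>The function is the sum over n of (1/2)^n * \<open>\<phi> n\<close> and the minimum of
  \<open>\<phi> 0\<close>, ..., \<open>\<phi> n\<close>. The weighted terms recover the topology:
  the rest of the series is lower semicontinuous over \<open>T\<close>, so it cannot drop much near
  a point, and a small rise of the whole sum bounds each single weighted term. The minima make the
  sum unbounded on non-empty clopen sets.\<close>

lemma unbounded_potential:
  assumes "cohesive X" and "topspace X \<noteq> {}"
  obtains f :: "'a \<Rightarrow> real" where "continuous_map X euclideanreal f" "lsc f" "\<And>x. x \<in> topspace X \<Longrightarrow> 0 \<le> f x"
    "\<And>C t. clopenin X C \<Longrightarrow> C \<noteq> {} \<Longrightarrow> \<exists>x\<in>C. t < f x"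
    "\<And>U x. openin X U \<Longrightarrow> x \<in> U \<Longrightarrow> \<exists>A\<in>Z. \<exists>\<delta>>0. x \<in> A \<and> (\<forall>y\<in>A. f y < f x + \<delta> \<longrightarrow> y \<in> U)"
proof -
  obtain \<phi> :: "nat \<Rightarrow> 'a \<Rightarrow> real" and V U where
    cont: "\<And>n. continuous_map X euclideanreal (\<phi> n)" and lsc: "\<And>n. lsc (\<phi> n)"
    and range: "\<And>n x. 0 \<le> \<phi> n x \<and> \<phi> n x \<le> 1"
    and V: "\<And>n. openin X (V n)" "\<And>n x. x \<in> V n \<Longrightarrow> \<phi> n x = 0" and U: "\<And>n x. \<phi> n x < 1 \<Longrightarrow> x \<in> U n"
    "\<And>n C. clopenin X C \<Longrightarrow> C \<subseteq> U n \<Longrightarrow> C = {}"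
    and base: "\<And>W x. openin X W \<Longrightarrow> x \<in> W \<Longrightarrow> \<exists>n. x \<in> V n \<and> U n \<subseteq> W"
    using bump_functions[OF assms] by metis
  \<comment> \<open>\<open>m n\<close> vanishes near each point for large \<open>n\<close>, so the sum below is locally finite; where it is
    at most \<open>t\<close>, some \<open>\<phi> j\<close> with \<open>j < N\<close> is at most \<open>1/2\<close>, for any \<open>N > 2 * t\<close>.\<close>
  define m where "m n x = Min ((\<lambda>j. \<phi> j x) ` {..n})" for n x
  have m_nonneg: "0 \<le> m n x" for n x
    using range by (auto simp: m_def)
  have m_zero: "m n x = 0" if x: "x \<in> V j" "j \<le> n" for n j x
  proof -
    have "m n x \<le> \<phi> j x" using x(2) by (auto simp: m_def intro!: Min_le)
    then show ?thesis using V(2)[OF x(1)] m_nonneg[of n x] by simp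
  qed
  have lsc_m: "lsc (m n)" for n
    unfolding lsc_def
  proof
    fix c
    have "{x \<in> topspace X. c < m n x} = (\<Inter>j\<in>{..n}. {x \<in> topspace X. c < \<phi> j x})"
      by (auto simp: m_def less_Min_image_iff)
    also have "openin T \<dots>"
      using lsc by (intro openin_INT2) (auto simp: lsc_def)
    finally show "openin T {x \<in> topspace X. c < m n x}" .
  qed
  have cont_m: "continuous_map X euclideanreal (m n)" for n
  proof -
    have "openin X {x \<in> topspace X. m n x < c}" for c
    proof -
      have "{x \<in> topspace X. m n x < c} = (\<Union>j\<in>{..n}. {x \<in> topspace X. \<phi> j x < c})"
        by (auto simp: m_def less_Min_image_iff)
      also have "openin X \<dots>"
        using cont by (intro openin_Union) (auto simp: continuous_map_upper_lower_semicontinuous_lt)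
      finally show ?thesis .
    qed
    moreover have "openin X {x \<in> topspace X. c < m n x}" for c
      using lsc_m coarser unfolding lsc_def by blast
    ultimately show ?thesis
      by (simp add: continuous_map_upper_lower_semicontinuous_lt)
  qed
  define a where "a n x = (1/2)^n * \<phi> n x + m n x" for n x
  have lsc_phi: "lsc (\<lambda>x. (1/2)^n * \<phi> n x)" for n
  proof -
    have "{x \<in> topspace X. c < (1/2)^n * \<phi> n x} = {x \<in> topspace X. 2^n * c < \<phi> n x}" for c
      by (auto simp: field_simps)
    then show ?thesis using lsc[of n] by (simp add: lsc_def)
  qed
  have lsc_a: "lsc (a n)" for n
    unfolding a_def by (intro lsc_add lsc_phi lsc_m)
  have a_nonneg: "0 \<le> a n x" for n x
    using range m_nonneg by (simp add: a_def)
  have cont_a: "continuous_map X euclideanreal (a n)" for n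
    unfolding a_def by (intro continuous_map_add continuous_map_real_mult_left cont cont_m)
  have a_le: "a n x \<le> (1/2)^n" if "x \<in> V j" "j \<le> n" for n j x
    using m_zero[OF that] range[of n x] by (simp add: a_def mult_left_le)
  have V_cover: "\<exists>j. x \<in> V j" if "x \<in> topspace X" for x
    using base[OF openin_topspace that] by blast
  have summable_half: "summable (\<lambda>n. (1/2::real)^n)" by (simp add: summable_geometric)
  have summable_a: "summable (\<lambda>n. a n x)" if x: "x \<in> topspace X" for x
  proof -
    obtain j where "x \<in> V j" using V_cover[OF x] by blast
    then show ?thesis
      using a_le[of x j] a_nonneg by (intro summable_comparison_test'[OF summable_half, of j]) auto
  qed
  define f where "f x = (\<Sum>n. a n x)" for x
  have f_lsc: "lsc f"
    unfolding f_def using lsc_a a_nonneg summable_a by (rule lsc_suminf)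
  have f_upper: "openin X {x \<in> topspace X. f x < c}" for c
  proof (subst openin_subopen, intro ballI)
    fix x assume "x \<in> {x \<in> topspace X. f x < c}"
    then have x: "x \<in> topspace X" "f x < c" by auto
    obtain j where j: "x \<in> V j" using V_cover[OF x(1)] by blast
    \<comment> \<open>One half of the distance to \<open>c\<close> is for the partial sum below
      \<open>J\<close>, the other for the tail. On \<open>V j\<close> the tail is at most 2 *
      (1/2)^J, because every \<open>m n\<close> with n >= j vanishes there.\<close>
    define e where "e = (c - f x) / 2"
    obtain k where k: "(1/2::real)^k < e / 2"
      using x(2) real_arch_pow_inv[of "e / 2" "1/2"] by (auto simp: e_def)
    define J where "J = max j k"
    have J: "2 * (1/2::real)^J < e"
    proof -
      have "(1/2::real)^J \<le> (1/2)^k" by (rule power_decreasing) (auto simp: J_def)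
      then show ?thesis using k by linarith
    qed
    let ?N = "V j \<inter> {y \<in> topspace X. (\<Sum>n<J. a n y) < f x + e}"
    have "continuous_map X euclideanreal (\<lambda>y. \<Sum>n<J. a n y)"
      using cont_a by (intro continuous_map_sum) auto
    then have "openin X ?N"
      using V(1) by (intro openin_Int) (auto simp: continuous_map_upper_lower_semicontinuous_lt)
    moreover have "x \<in> ?N"
      using x j sum_le_suminf[OF summable_a[OF x(1)], of "{..<J}"] a_nonneg
      by (auto simp: f_def e_def field_simps)
    moreover have "f y < c" if y: "y \<in> ?N" for y
    proof -
      have sy: "summable (\<lambda>n. a n y)" using y summable_a by auto
      have "f y = (\<Sum>n. a (n + J) y) + (\<Sum>n<J. a n y)"
        unfolding f_def by (rule suminf_split_initial_segment[OF sy])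
      also have "(\<Sum>n. a (n + J) y) \<le> (\<Sum>n. (1/2)^J * (1/2)^n)"
      proof (rule suminf_le)
        show "a (n + J) y \<le> (1/2)^J * (1/2)^n" for n
          using a_le[of y j "n + J"] y by (simp add: J_def power_add mult.commute)
        show "summable (\<lambda>n. a (n + J) y)"
          by (rule summable_ignore_initial_segment[OF sy])
        show "summable (\<lambda>n. (1/2::real)^J * (1/2)^n)"
          using summable_half by (rule summable_mult)
      qed
      also have "\<dots> = 2 * (1/2)^J"
        using suminf_mult[OF summable_half, of "(1/2)^J"] suminf_geometric[of "1/2::real"] by simp
      finally have "f y \<le> 2 * (1/2)^J + (\<Sum>n<J. a n y)" by simp
      moreover have "(\<Sum>n<J. a n y) < f x + e" using y by simp
      ultimately have "f y < f x + e + e" using J by linarith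
      then show ?thesis by (simp add: e_def)
    qed
    ultimately show "\<exists>N. openin X N \<and> x \<in> N \<and> N \<subseteq> {x \<in> topspace X. f x < c}"
      by (intro exI[of _ ?N]) auto
  qed
  have "continuous_map X euclideanreal f"
    unfolding continuous_map_upper_lower_semicontinuous_lt
    using f_upper f_lsc coarser by (auto simp: lsc_def)
  moreover have "0 \<le> f x" if "x \<in> topspace X" for x
    unfolding f_def using summable_a[OF that] a_nonneg by (intro suminf_nonneg) auto
  moreover have "\<exists>x\<in>C. t < f x" if C: "clopenin X C" "C \<noteq> {}" for C t
  proof (rule ccontr)
    assume "\<not> (\<exists>x\<in>C. t < f x)"
    then have ft: "f x \<le> t" if "x \<in> C" for x using that by force
    obtain N :: nat where N: "2 * t < real N" using reals_Archimedean2 by blast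
    have "C \<subseteq> (\<Union>j<N. {x. \<phi> j x \<le> 1/2})"
    proof
      fix x assume x: "x \<in> C"
      show "x \<in> (\<Union>j<N. {x. \<phi> j x \<le> 1/2})"
      proof (rule ccontr)
        assume "x \<notin> (\<Union>j<N. {x. \<phi> j x \<le> 1/2})"
        then have "1/2 < \<phi> j x" if "j < N" for j using that by force
        then have "1/2 \<le> a n x" if "n < N" for n
        proof -
          have "1/2 < m n x" using \<open>n < N\<close> \<open>\<And>j. j < N \<Longrightarrow> 1/2 < \<phi> j x\<close>
            unfolding m_def less_Min_image_iff by auto
          then show ?thesis using range[of n x] by (simp add: a_def add_increasing)
        qed
        then have "(\<Sum>n<N. 1/2) \<le> (\<Sum>n<N. a n x)" by (intro sum_mono) auto
        also have "\<dots> \<le> f x"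
          using x C(1) openin_subset a_nonneg summable_a unfolding f_def clopenin_def
          by (intro sum_le_suminf) blast+
        finally show False using ft[OF x] N by simp
      qed
    qed
    moreover have "D = {}" if "clopenin X D" "D \<subseteq> {x. \<phi> n x \<le> 1/2}" for n D
      using U(2)[OF that(1), of n] that(2) U(1)[of n] by force
    ultimately show False
      using no_clopen_in_finite_union[of \<phi> "1/2" C N] lsc C by blast
  qed
  moreover have "\<exists>A\<in>Z. \<exists>\<delta>>0. x \<in> A \<and> (\<forall>y\<in>A. f y < f x + \<delta> \<longrightarrow> y \<in> W)"
    if W: "openin X W" "x \<in> W" for W x
  proof -
    have x: "x \<in> topspace X" using W openin_subset by blast
    obtain n where n: "x \<in> V n" "U n \<subseteq> W" using base[OF W] by blast
    \<comment> \<open>\<open>b\<close> is \<open>a\<close> without the weighted term of index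
      \<open>n\<close>; its sum \<open>r\<close> is what remains of \<open>f\<close> when that term
      is taken out.\<close>
    define b where "b k = (if k = n then m n else a k)" for k
    define r where "r y = (\<Sum>k. b k y)" for y
    have ab: "a k y = b k y + (if k = n then (1/2)^n * \<phi> n y else 0)" for k y
      by (simp add: a_def b_def)
    have b: "0 \<le> b k y \<and> b k y \<le> a k y" for k y
      using m_nonneg a_nonneg range by (auto simp: b_def a_def)
    have sb: "summable (\<lambda>k. b k y)" if "y \<in> topspace X" for y
      using b by (intro summable_comparison_test'[OF summable_a[OF that], of 0]) auto
    have fr: "f y = r y + (1/2)^n * \<phi> n y" if "y \<in> topspace X" for y
    proof -
      have "(\<lambda>k. a k y) sums (r y + (1/2)^n * \<phi> n y)"
        unfolding ab r_def
        using sums_single[of n "\<lambda>k. (1/2)^n * \<phi> n y"]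
        by (intro sums_add summable_sums[OF sb[OF that]]) simp
      then show ?thesis unfolding f_def by (simp add: sums_iff)
    qed
    have "lsc r"
      unfolding r_def using lsc_a lsc_m b sb by (intro lsc_suminf) (auto simp: b_def)
    \<comment> \<open>Half the weight of \<open>\<phi> n\<close>: \<open>\<delta>\<close> is spent
      twice, on the possible drop of \<open>r\<close> and on the allowed rise of
      \<open>f\<close>.\<close>
    define \<delta> :: real where "\<delta> = (1/2)^n / 2"
    have "\<delta> > 0" by (simp add: \<delta>_def)
    have "openin T {y \<in> topspace X. r x - \<delta> < r y}" using \<open>lsc r\<close> by (simp add: lsc_def)
    moreover have "x \<in> {y \<in> topspace X. r x - \<delta> < r y}" using x \<open>\<delta> > 0\<close> by simp
    ultimately obtain A where A: "A \<in> Z" "x \<in> A" "A \<subseteq> {y \<in> topspace X. r x - \<delta> < r y}"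
      using Z_base by meson
    have "y \<in> W" if y: "y \<in> A" "f y < f x + \<delta>" for y
    proof -
      have "y \<in> topspace X" "r x - \<delta> < r y" using y A(3) by auto
      moreover have "f x = r x" using fr[OF x] V(2)[OF n(1)] by simp
      ultimately have "(1/2)^n * \<phi> n y < (1/2)^n"
        using y(2) fr[of y] unfolding \<delta>_def by linarith
      then have "\<phi> n y < 1" by simp
      then show ?thesis using U(1) n(2) by blast
    qed
    then show ?thesis using A(1,2) \<open>\<delta> > 0\<close> by blast
  qed
  ultimately show ?thesis
    using f_lsc by (intro that[of f])
qed

end

section \<open>The back-and-forth construction\<close>

definition splitting :: "'a set set \<Rightarrow> ('a \<Rightarrow> real) \<Rightarrow> bool" where
  "splitting \<A> f \<longleftrightarrow> (\<forall>A\<in>\<A>. A \<noteq> {} \<longrightarrow> (\<forall>b\<ge>0. \<forall>e>0. \<exists>B\<in>\<A>. B \<subseteq> A \<and> B \<noteq> {} \<and> A - B \<noteq> {} \<and>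
     \<bar>Inf (f ` B) - (Inf (f ` A) + b)\<bar> < e \<and> \<bar>Inf (f ` (A - B)) - Inf (f ` A)\<bar> < e))"

definition splitting_algebra :: "'a set \<Rightarrow> 'a set set \<Rightarrow> ('a \<Rightarrow> real) \<Rightarrow> bool" where
  "splitting_algebra X \<A> f \<longleftrightarrow> X \<in> \<A> \<and> X \<noteq> {} \<and> (\<forall>A\<in>\<A>. A \<subseteq> X) \<and>
     (\<forall>A\<in>\<A>. \<forall>B\<in>\<A>. A \<inter> B \<in> \<A> \<and> A - B \<in> \<A>) \<and> (\<forall>x\<in>X. 0 \<le> f x) \<and> splitting \<A> f"

text \<open>Two finite partitions into non-empty pieces with a bijection between them. The bijection
  is implicit: distinct pairs are disjoint in both components, so no piece can occur in two
  pairs.\<close>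

definition matching :: "'a set \<Rightarrow> 'b set \<Rightarrow> ('a set \<times> 'b set) set \<Rightarrow> bool" where
  "matching X Y R \<longleftrightarrow> finite R \<and> (\<forall>r\<in>R. fst r \<noteq> {} \<and> snd r \<noteq> {}) \<and>
     (\<Union>r\<in>R. fst r) = X \<and> (\<Union>r\<in>R. snd r) = Y \<and>
     (\<forall>r\<in>R. \<forall>s\<in>R. r \<noteq> s \<longrightarrow> fst r \<inter> fst s = {} \<and> snd r \<inter> snd s = {})"

text \<open>The defects of matched pieces need not vanish: they only have to form a Cauchy sequence along
  decreasing pieces, and their limit is what the norm of the embedding misses from \<open>f\<close>.\<close>

definition defect :: "('a \<Rightarrow> real) \<Rightarrow> ('b \<Rightarrow> real) \<Rightarrow> 'a set \<times> 'b set \<Rightarrow> real" where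
  "defect f g r = Inf (f ` fst r) - Inf (g ` snd r)"

definition refines :: "('a \<Rightarrow> real) \<Rightarrow> ('b \<Rightarrow> real) \<Rightarrow> real \<Rightarrow>
    ('a set \<times> 'b set) set \<Rightarrow> ('a set \<times> 'b set) set \<Rightarrow> bool" where
  "refines f g e R R' \<longleftrightarrow>
     (\<forall>r'\<in>R'. \<exists>r\<in>R. fst r' \<subseteq> fst r \<and> snd r' \<subseteq> snd r \<and> \<bar>defect f g r' - defect f g r\<bar> < e)"

definition decides :: "'a set \<Rightarrow> 'a set set \<Rightarrow> bool" where
  "decides A \<P> \<longleftrightarrow> (\<forall>P\<in>\<P>. P \<subseteq> A \<or> P \<inter> A = {})"

lemma bdd_below_nonneg_image: "(\<And>x. x \<in> A \<Longrightarrow> (0::real) \<le> f x) \<Longrightarrow> bdd_below (f ` A)"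
  by (auto intro!: bdd_belowI2)

lemma matching_piece:
  assumes "matching X Y R" and "r \<in> R"
  shows "fst r \<subseteq> X \<and> snd r \<subseteq> Y \<and> fst r \<noteq> {} \<and> snd r \<noteq> {}"
proof -
  have "(\<Union>r\<in>R. fst r) = X" "(\<Union>r\<in>R. snd r) = Y" and *: "\<forall>r\<in>R. fst r \<noteq> {} \<and> snd r \<noteq> {}"
    using assms(1) by (simp_all add: matching_def)
  then have "fst r \<subseteq> X" "snd r \<subseteq> Y"
    using UN_upper[OF assms(2), of fst] UN_upper[OF assms(2), of snd] by simp_all
  then show ?thesis using * assms(2) by simp
qed

lemma matching_disjoint:
  assumes "matching X Y R" and "r \<in> R" and "s \<in> R" and "r \<noteq> s"
  shows "fst r \<inter> fst s = {} \<and> snd r \<inter> snd s = {}"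
  using assms by (simp add: matching_def)

lemma matching_swap: "matching X Y R \<Longrightarrow> matching Y X (prod.swap ` R)"
  by (simp add: matching_def image_image inj_eq[OF inj_swap] conj_commute)

lemma refines_swap: "refines f g e R R' \<Longrightarrow> refines g f e (prod.swap ` R) (prod.swap ` R')"
  unfolding refines_def defect_def by (simp add: abs_minus_commute algebra_simps) metis

lemma refines_trans:
  assumes "refines f g d R R'" and "refines f g e R' R''"
  shows "refines f g (d + e) R R''"
  unfolding refines_def
proof
  fix r'' assume "r'' \<in> R''"
  then obtain r' where r': "r' \<in> R'" "fst r'' \<subseteq> fst r'" "snd r'' \<subseteq> snd r'" "\<bar>defect f g r'' - defect f g r'\<bar> < e"
    using assms(2) unfolding refines_def by meson
  then obtain r where r: "r \<in> R" "fst r' \<subseteq> fst r" "snd r' \<subseteq> snd r" "\<bar>defect f g r' - defect f g r\<bar> < d"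
    using assms(1) unfolding refines_def by meson
  show "\<exists>r\<in>R. fst r'' \<subseteq> fst r \<and> snd r'' \<subseteq> snd r \<and> \<bar>defect f g r'' - defect f g r\<bar> < d + e"
    using r r' by (intro bexI[of _ r]) auto
qed

lemma decides_mono:
  assumes "decides A \<P>" and "\<And>P'. P' \<in> \<P>' \<Longrightarrow> \<exists>P\<in>\<P>. P' \<subseteq> P"
  shows "decides A \<P>'"
  using assms unfolding decides_def by (meson disjoint_iff subset_iff)

text \<open>If \<open>A\<close> really cuts \<open>P\<close>, let \<open>P1\<close> be a half that
  keeps the infimum of \<open>P\<close> and let \<open>b\<close> be the rise on the other half
  \<open>P2\<close>. Splitting \<open>Q\<close> with the same \<open>b\<close> gives a half
  \<open>B\<close> with nearly the same rise, to be paired with \<open>P2\<close>, while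
  \<open>Q - B\<close> nearly keeps its infimum and is paired with \<open>P1\<close>; both defects
  then move by less than \<open>e\<close>.\<close>

lemma match_one_piece:
  assumes X: "splitting_algebra X \<A> f" and Y: "splitting_algebra Y \<B> g"
    and P: "P \<in> \<A>" "P \<noteq> {}" and Q: "Q \<in> \<B>" "Q \<noteq> {}" and A: "A \<in> \<A>" and "e > 0"
  shows "\<exists>R. matching P Q R \<and> R \<subseteq> \<A> \<times> \<B> \<and> (\<forall>r\<in>R. \<bar>defect f g r - defect f g (P, Q)\<bar> < e) \<and> decides A (fst ` R)"
proof (cases "P \<subseteq> A \<or> P \<inter> A = {}")
  case True
  then show ?thesis
    using P Q \<open>e > 0\<close> by (intro exI[of _ "{(P, Q)}"]) (auto simp: matching_def decides_def)
next
  case False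
  have bdd: "bdd_below (f ` S)" if "S \<subseteq> P" for S
    using X P that unfolding splitting_algebra_def by (intro bdd_below_nonneg_image) blast
  have *: "Inf (f ` P) = min (Inf (f ` (P \<inter> A))) (Inf (f ` (P - A)))"
  proof -
    have "Inf (f ` P) = Inf (f ` (P \<inter> A) \<union> f ` (P - A))"
      by (rule arg_cong[where f = Inf]) auto
    also have "\<dots> = inf (Inf (f ` (P \<inter> A))) (Inf (f ` (P - A)))"
      using False bdd by (intro cInf_union_distrib) auto
    finally show ?thesis by (simp add: inf_min)
  qed
  have "P \<inter> A \<in> \<A>" "P - A \<in> \<A>"
    using X P(1) A unfolding splitting_algebra_def by blast+
  then obtain P1 P2 where P12: "P1 \<in> \<A>" "P2 \<in> \<A>" "P1 \<noteq> {}" "P2 \<noteq> {}" "P1 \<union> P2 = P" "P1 \<inter> P2 = {}"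
    "decides A {P1, P2}" "Inf (f ` P1) = Inf (f ` P)" "Inf (f ` P) \<le> Inf (f ` P2)"
  proof (cases "Inf (f ` (P \<inter> A)) \<le> Inf (f ` (P - A))")
    case True
    then show thesis
      using False \<open>P \<inter> A \<in> \<A>\<close> \<open>P - A \<in> \<A>\<close> *
      by (intro that[of "P \<inter> A" "P - A"]) (auto simp: decides_def)
  next
    case False': False
    then show thesis
      using False \<open>P \<inter> A \<in> \<A>\<close> \<open>P - A \<in> \<A>\<close> *
      by (intro that[of "P - A" "P \<inter> A"]) (auto simp: decides_def)
  qed
  define b where "b = Inf (f ` P2) - Inf (f ` P)"
  have "b \<ge> 0" using P12 by (simp add: b_def)
  have "splitting \<B> g" using Y by (simp add: splitting_algebra_def)
  then obtain B where B: "B \<in> \<B>" "B \<subseteq> Q" "B \<noteq> {}" "Q - B \<noteq> {}"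
    "\<bar>Inf (g ` B) - (Inf (g ` Q) + b)\<bar> < e" "\<bar>Inf (g ` (Q - B)) - Inf (g ` Q)\<bar> < e"
    using Q \<open>b \<ge> 0\<close> \<open>e > 0\<close> unfolding splitting_def by meson
  have "Q - B \<in> \<B>" using Y Q(1) B(1) unfolding splitting_algebra_def by blast
  define R where "R = {(P1, Q - B), (P2, B)}"
  have "matching P Q R"
    using P12 B unfolding matching_def R_def by auto
  moreover have "R \<subseteq> \<A> \<times> \<B>"
    using P12 B \<open>Q - B \<in> \<B>\<close> by (auto simp: R_def)
  moreover have "\<forall>r\<in>R. \<bar>defect f g r - defect f g (P, Q)\<bar> < e"
    using P12 B by (auto simp: R_def defect_def b_def)
  moreover have "decides A (fst ` R)"
    using P12 by (simp add: R_def)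
  ultimately show ?thesis by blast
qed

lemma match_refine:
  assumes X: "splitting_algebra X \<A> f" and Y: "splitting_algebra Y \<B> g"
    and R: "matching X Y R" "R \<subseteq> \<A> \<times> \<B>" and A: "A \<in> \<A>" and "e > 0"
  shows "\<exists>R'. matching X Y R' \<and> R' \<subseteq> \<A> \<times> \<B> \<and> refines f g e R R' \<and> decides A (fst ` R')"
proof -
  have "\<forall>r\<in>R. \<exists>S. matching (fst r) (snd r) S \<and> S \<subseteq> \<A> \<times> \<B> \<and>
     (\<forall>s\<in>S. \<bar>defect f g s - defect f g r\<bar> < e) \<and> decides A (fst ` S)"
  proof
    fix r assume r: "r \<in> R"
    obtain P Q where PQ: "r = (P, Q)" by fastforce
    have "P \<in> \<A>" "P \<noteq> {}" "Q \<in> \<B>" "Q \<noteq> {}"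
      using r R PQ by (auto simp: matching_def)
    then show "\<exists>S. matching (fst r) (snd r) S \<and> S \<subseteq> \<A> \<times> \<B> \<and>
       (\<forall>s\<in>S. \<bar>defect f g s - defect f g r\<bar> < e) \<and> decides A (fst ` S)"
      using match_one_piece[OF X Y _ _ _ _ A \<open>e > 0\<close>] PQ by simp
  qed
  then obtain S where S: "\<forall>r\<in>R. matching (fst r) (snd r) (S r) \<and> S r \<subseteq> \<A> \<times> \<B> \<and>
     (\<forall>s\<in>S r. \<bar>defect f g s - defect f g r\<bar> < e) \<and> decides A (fst ` S r)"
    by (rule bchoice[THEN exE])
  have mS: "matching (fst r) (snd r) (S r)" if "r \<in> R" for r
    using S that by blast
  have sub: "fst s \<subseteq> fst r \<and> snd s \<subseteq> snd r \<and> fst s \<noteq> {} \<and> snd s \<noteq> {}" if "r \<in> R" "s \<in> S r" for r s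
    using matching_piece[OF mS[OF that(1)] that(2)] .
  define R' where "R' = (\<Union>r\<in>R. S r)"
  have disj: "fst s \<inter> fst s' = {} \<and> snd s \<inter> snd s' = {}"
    if s: "r \<in> R" "s \<in> S r" "r' \<in> R" "s' \<in> S r'" "s \<noteq> s'" for r s r' s'
  proof (cases "r = r'")
    case True
    then show ?thesis using matching_disjoint[OF mS[OF s(1)] s(2) _ s(5)] s(4) by simp
  next
    case False
    then have "fst r \<inter> fst r' = {} \<and> snd r \<inter> snd r' = {}"
      using matching_disjoint[OF R(1) s(1,3)] by simp
    then show ?thesis using sub[OF s(1,2)] sub[OF s(3,4)] by blast
  qed
  have un: "(\<Union>s\<in>S r. fst s) = fst r \<and> (\<Union>s\<in>S r. snd s) = snd r \<and> finite (S r)" if "r \<in> R" for r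
    using mS[OF that] by (simp add: matching_def)
  have "matching X Y R'"
    unfolding matching_def
  proof (intro conjI ballI impI)
    show "finite R'" using R(1) un by (simp add: R'_def matching_def)
    have "(\<Union>r\<in>R'. fst r) = (\<Union>r\<in>R. \<Union>s\<in>S r. fst s)" by (auto simp: R'_def)
    also have "\<dots> = X" using un R(1) by (simp add: matching_def)
    finally show "(\<Union>r\<in>R'. fst r) = X" .
    have "(\<Union>r\<in>R'. snd r) = (\<Union>r\<in>R. \<Union>s\<in>S r. snd s)" by (auto simp: R'_def)
    also have "\<dots> = Y" using un R(1) by (simp add: matching_def)
    finally show "(\<Union>r\<in>R'. snd r) = Y" .
    show "fst s \<noteq> {}" "snd s \<noteq> {}" if "s \<in> R'" for s
      using that sub unfolding R'_def by blast+
    show "fst s \<inter> fst s' = {}" "snd s \<inter> snd s' = {}" if "s \<in> R'" "s' \<in> R'" "s \<noteq> s'" for s s'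
      using that disj unfolding R'_def by blast+
  qed
  moreover have "R' \<subseteq> \<A> \<times> \<B>" using S unfolding R'_def by blast
  moreover have "refines f g e R R'"
    unfolding refines_def
  proof
    fix s assume "s \<in> R'"
    then obtain r where r: "r \<in> R" "s \<in> S r" by (auto simp: R'_def)
    then have "\<bar>defect f g s - defect f g r\<bar> < e" using S by blast
    then show "\<exists>r\<in>R. fst s \<subseteq> fst r \<and> snd s \<subseteq> snd r \<and> \<bar>defect f g s - defect f g r\<bar> < e"
      using sub[OF r] r(1) by (intro bexI[of _ r]) simp_all
  qed
  moreover have "decides A (fst ` R')"
    using S unfolding R'_def decides_def by blast
  ultimately show ?thesis by blast
qed

text \<open>One step forth and, after swapping the two sides, one step back, each at the cost of
  \<open>e / 2\<close>. The second step only shrinks pieces, so it preserves the decision made by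
  the first.\<close>

lemma match_refine2:
  assumes X: "splitting_algebra X \<A> f" and Y: "splitting_algebra Y \<B> g"
    and R: "matching X Y R" "R \<subseteq> \<A> \<times> \<B>" and A: "A \<in> \<A>" and B: "B \<in> \<B>" and "e > 0"
  shows "\<exists>R'. matching X Y R' \<and> R' \<subseteq> \<A> \<times> \<B> \<and> refines f g e R R' \<and> decides A (fst ` R') \<and> decides B (snd ` R')"
proof -
  have "e / 2 > 0" using \<open>e > 0\<close> by simp
  obtain R1 where R1: "matching X Y R1" "R1 \<subseteq> \<A> \<times> \<B>" "refines f g (e/2) R R1" "decides A (fst ` R1)"
    using match_refine[OF X Y R A \<open>e / 2 > 0\<close>] by blast
  have "prod.swap ` R1 \<subseteq> \<B> \<times> \<A>" using R1(2) by auto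
  then obtain S where S: "matching Y X S" "S \<subseteq> \<B> \<times> \<A>" "refines g f (e/2) (prod.swap ` R1) S" "decides B (fst ` S)"
    using match_refine[OF Y X matching_swap[OF R1(1)] _ B \<open>e / 2 > 0\<close>] by blast
  define R' where "R' = prod.swap ` S"
  have "matching X Y R'" unfolding R'_def by (rule matching_swap[OF S(1)])
  moreover have "R' \<subseteq> \<A> \<times> \<B>" using S(2) by (auto simp: R'_def)
  moreover have ref: "refines f g (e/2) R1 R'"
    using refines_swap[OF S(3)] by (simp add: R'_def image_comp)
  then have "refines f g e R R'"
    using refines_trans[OF R1(3) ref] by simp
  moreover have "decides A (fst ` R')"
  proof (rule decides_mono[OF R1(4)])
    fix P' assume "P' \<in> fst ` R'"
    then obtain r' where "r' \<in> R'" "P' = fst r'" by auto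
    then obtain r where "r \<in> R1" "P' \<subseteq> fst r" using ref unfolding refines_def by meson
    then show "\<exists>P\<in>fst ` R1. P' \<subseteq> P" by auto
  qed
  moreover have "decides B (snd ` R')"
    using S(4) by (simp add: R'_def image_comp)
  ultimately show ?thesis by blast
qed

text \<open>The errors are summable, so along nested pieces the defects are Cauchy at a rate common
  to all of them. Starting from a single pair keeps every later defect within 2 of the initial
  one.\<close>

lemma matching_sequence:
  fixes A :: "nat \<Rightarrow> 'a set" and B :: "nat \<Rightarrow> 'b set"
  assumes X: "splitting_algebra X \<A> f" and Y: "splitting_algebra Y \<B> g"
    and A: "\<And>n. A n \<in> \<A>" and B: "\<And>n. B n \<in> \<B>"
  obtains R where "R 0 = {(X, Y)}" "\<And>n. matching X Y (R n)" "\<And>n. R n \<subseteq> \<A> \<times> \<B>"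
    "\<And>n. refines f g ((1/2)^n) (R n) (R (Suc n))"
    "\<And>n. decides (A n) (fst ` R (Suc n))" "\<And>n. decides (B n) (snd ` R (Suc n))"
proof -
  have "\<exists>R. \<forall>n. (matching X Y (R n) \<and> R n \<subseteq> \<A> \<times> \<B> \<and> (n = 0 \<longrightarrow> R n = {(X, Y)})) \<and>
    (refines f g ((1/2)^n) (R n) (R (Suc n)) \<and> decides (A n) (fst ` R (Suc n)) \<and> decides (B n) (snd ` R (Suc n)))"
  proof (rule dependent_nat_choice)
    show "\<exists>R. matching X Y R \<and> R \<subseteq> \<A> \<times> \<B> \<and> ((0::nat) = 0 \<longrightarrow> R = {(X, Y)})"
      using X Y by (intro exI[of _ "{(X, Y)}"]) (simp add: matching_def splitting_algebra_def)
    show "\<exists>S. (matching X Y S \<and> S \<subseteq> \<A> \<times> \<B> \<and> (Suc n = 0 \<longrightarrow> S = {(X, Y)})) \<and>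
      (refines f g ((1/2)^n) R S \<and> decides (A n) (fst ` S) \<and> decides (B n) (snd ` S))"
      if "matching X Y R \<and> R \<subseteq> \<A> \<times> \<B> \<and> (n = 0 \<longrightarrow> R = {(X, Y)})" for R n
      using match_refine2[OF X Y _ _ A[of n] B[of n], of R "(1/2)^n"] that by simp
  qed
  then obtain R where R: "\<forall>n. (matching X Y (R n) \<and> R n \<subseteq> \<A> \<times> \<B> \<and> (n = 0 \<longrightarrow> R n = {(X, Y)})) \<and>
    (refines f g ((1/2)^n) (R n) (R (Suc n)) \<and> decides (A n) (fst ` R (Suc n)) \<and> decides (B n) (snd ` R (Suc n)))"
    by (elim exE)
  show ?thesis by (rule that[of R]) (use R in auto)
qed

section \<open>The Hilbert space and complete Erdos space\<close>

lemma openin_l2_topology: "openin l2_topology = l2_open"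
  unfolding l2_topology_def by (rule topology_inverse'[OF istopology_l2_open])

lemma topspace_l2_topology [simp]: "topspace l2_topology = l2"
proof -
  have "l2_open l2" unfolding l2_open_def by (auto intro: exI[of _ 1])
  moreover have "U \<subseteq> l2" if "l2_open U" for U
    using that by (simp add: l2_open_def)
  ultimately show ?thesis
    unfolding topspace_def openin_l2_topology by blast
qed

lemma topspace_erdos_c_topology [simp]: "topspace erdos_c_topology = erdos_c"
  by (auto simp: erdos_c_topology_def erdos_c_def)

abbreviation sqnorm :: "(nat \<Rightarrow> real) \<Rightarrow> real" where
  "sqnorm x \<equiv> (\<Sum>i. (x i)\<^sup>2)"

lemma sqnorm_eq: "x \<in> l2 \<Longrightarrow> sqnorm x = (l2_norm x)\<^sup>2"
  by (simp add: l2_norm_def l2_def suminf_nonneg)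

lemma l2_norm_nonneg: "x \<in> l2 \<Longrightarrow> 0 \<le> l2_norm x"
  by (simp add: l2_norm_def l2_def suminf_nonneg)

lemma partial_sqnorm_le: "x \<in> l2 \<Longrightarrow> (\<Sum>i<n. (x i)\<^sup>2) \<le> sqnorm x"
  by (intro sum_le_suminf) (auto simp: l2_def)

lemma l2_triangle:
  assumes "x \<in> l2" and "y \<in> l2"
  shows "(\<lambda>i. x i + y i) \<in> l2 \<and> l2_norm (\<lambda>i. x i + y i) \<le> l2_norm x + l2_norm y"
proof -
  let ?N = "l2_norm x + l2_norm y"
  have le: "L2_set z {..<n} \<le> l2_norm z" if "z \<in> l2" for z n
    using partial_sqnorm_le[OF that] by (simp add: L2_set_def l2_norm_def)
  have "(\<Sum>i<n. (x i + y i)\<^sup>2) \<le> ?N\<^sup>2" for n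
  proof -
    have "L2_set (\<lambda>i. x i + y i) {..<n} \<le> L2_set x {..<n} + L2_set y {..<n}"
      by (rule L2_set_triangle_ineq)
    then have "L2_set (\<lambda>i. x i + y i) {..<n} \<le> ?N"
      using le[OF assms(1), of n] le[OF assms(2), of n] by linarith
    then have "(L2_set (\<lambda>i. x i + y i) {..<n})\<^sup>2 \<le> ?N\<^sup>2"
      by (intro power_mono) (auto simp: L2_set_nonneg)
    then show ?thesis by (simp add: L2_set_def sum_nonneg)
  qed
  note bound = this
  have s: "summable (\<lambda>i. (x i + y i)\<^sup>2)"
    by (rule summableI_nonneg_bounded[OF _ bound]) simp
  then have "sqnorm (\<lambda>i. x i + y i) \<le> ?N\<^sup>2"
    using bound by (intro suminf_le_const)
  then have "l2_norm (\<lambda>i. x i + y i) \<le> ?N"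
    using l2_norm_nonneg assms unfolding l2_norm_def[of "\<lambda>i. x i + y i"] by (intro real_le_lsqrt) auto
  then show ?thesis using s by (simp add: l2_def)
qed

lemma l2_uminus: "x \<in> l2 \<Longrightarrow> (\<lambda>i. - x i) \<in> l2"
  by (simp add: l2_def)

lemma l2_diff: "x \<in> l2 \<Longrightarrow> y \<in> l2 \<Longrightarrow> (\<lambda>i. x i - y i) \<in> l2"
  using l2_triangle[of x "\<lambda>i. - y i"] l2_uminus by simp

lemma l2_dist_coordinate:
  assumes "x \<in> l2" and "y \<in> l2"
  shows "\<bar>x i - y i\<bar> \<le> l2_dist x y"
proof -
  have "(x i - y i)\<^sup>2 \<le> sqnorm (\<lambda>i. x i - y i)"
    using l2_diff[OF assms] sum_le_suminf[of "\<lambda>i. (x i - y i)\<^sup>2" "{i}"] by (simp add: l2_def)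
  then show ?thesis
    unfolding l2_dist_def l2_norm_def by (simp add: real_le_rsqrt)
qed

lemma l2_dist_nonneg: "x \<in> l2 \<Longrightarrow> y \<in> l2 \<Longrightarrow> 0 \<le> l2_dist x y"
  unfolding l2_dist_def by (intro l2_norm_nonneg l2_diff)

lemma l2_dist_commute: "l2_dist x y = l2_dist y x"
  by (simp add: l2_dist_def l2_norm_def power2_commute)

text \<open>The absolute value is there because \<open>l2_dist\<close> is unspecified, hence possibly negative,
  outside \<open>l2\<close>.\<close>

lemma Metric_space_l2: "Metric_space l2 (\<lambda>x y. \<bar>l2_dist x y\<bar>)"
proof
  show "\<bar>l2_dist x y\<bar> = \<bar>l2_dist y x\<bar>" for x y
    by (simp add: l2_dist_commute)
  show "\<bar>l2_dist x y\<bar> = 0 \<longleftrightarrow> x = y" if "x \<in> l2" "y \<in> l2" for x y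
  proof
    assume "\<bar>l2_dist x y\<bar> = 0"
    then have "x i = y i" for i using l2_dist_coordinate[OF that, of i] by simp
    then show "x = y" by auto
  qed (simp add: l2_dist_def l2_norm_def)
  show "\<bar>l2_dist x z\<bar> \<le> \<bar>l2_dist x y\<bar> + \<bar>l2_dist y z\<bar>" if "x \<in> l2" "y \<in> l2" "z \<in> l2" for x y z
    using l2_triangle[OF l2_diff[OF that(1,2)] l2_diff[OF that(2,3)]] l2_dist_nonneg that
    by (simp add: l2_dist_def)
qed simp

interpretation l2: Metric_space l2 "\<lambda>x y. \<bar>l2_dist x y\<bar>"
  by (rule Metric_space_l2)

lemma mtopology_l2: "l2.mtopology = l2_topology"
proof -
  have "openin l2.mtopology U \<longleftrightarrow> openin l2_topology U" for U
  proof (cases "U \<subseteq> l2")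
    case True
    have "l2.mball x e \<subseteq> U \<longleftrightarrow> (\<forall>y\<in>l2. l2_dist x y < e \<longrightarrow> y \<in> U)" if "x \<in> U" for x e
    proof -
      have "x \<in> l2" using True that by blast
      then show ?thesis using l2_dist_nonneg by (auto simp: l2.mball_def)
    qed
    then show ?thesis
      using True by (simp add: openin_l2_topology l2_open_def l2.openin_mtopology Ball_def)
  qed (simp add: openin_l2_topology l2_open_def l2.openin_mtopology)
  then show ?thesis by (simp add: topology_eq)
qed

lemma sqnorm_upper_semicontinuous:
  assumes "x \<in> l2" and "e > 0"
  shows "\<exists>d>0. \<forall>y\<in>l2. l2_dist x y < d \<longrightarrow> sqnorm y < sqnorm x + e"
proof -
  have "isCont (\<lambda>t. (l2_norm x + t)\<^sup>2) 0" by (intro continuous_intros)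
  then obtain d where d: "d > 0" "\<And>t. \<bar>t\<bar> < d \<Longrightarrow> \<bar>(l2_norm x + t)\<^sup>2 - (l2_norm x)\<^sup>2\<bar> < e"
    using assms(2) unfolding continuous_at_eps_delta by (force simp: dist_real_def)
  have "sqnorm y < sqnorm x + e" if y: "y \<in> l2" "l2_dist x y < d" for y
  proof -
    have "l2_norm y \<le> l2_norm x + l2_dist y x"
      using l2_triangle[OF assms(1) l2_diff[OF y(1) assms(1)]] by (simp add: l2_dist_def)
    then have "(l2_norm y)\<^sup>2 \<le> (l2_norm x + l2_dist x y)\<^sup>2"
      using l2_norm_nonneg[OF y(1)] by (intro power_mono) (auto simp: l2_dist_commute)
    also have "\<dots> < (l2_norm x)\<^sup>2 + e"
      using d(2)[of "l2_dist x y"] y(2) l2_dist_nonneg[OF assms(1) y(1)] by linarith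
    finally show ?thesis using sqnorm_eq y(1) assms(1) by simp
  qed
  then show ?thesis using d(1) by blast
qed

section \<open>Coordinatewise tests and cylinders in complete Erdos space\<close>

text \<open>Basic neighbourhoods for coordinatewise convergence on \<open>erdos_c\<close>, expressed
  by finitely many tests with clopen answers. Vanishing of a coordinate is never tested, because 0
  is not isolated among the admissible values.\<close>

definition agree :: "nat \<Rightarrow> (nat \<Rightarrow> real) \<Rightarrow> (nat \<Rightarrow> real) \<Rightarrow> bool" where
  "agree k x y \<longleftrightarrow> (\<forall>i<k. \<forall>m<k. x i = 1 / real (Suc m) \<longleftrightarrow> y i = 1 / real (Suc m))"

lemma agree_sym: "agree k x y \<Longrightarrow> agree k y x"
  by (simp add: agree_def)

lemma agree_mono: "agree k x y \<Longrightarrow> j \<le> k \<Longrightarrow> agree j x y"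
  by (simp add: agree_def)

lemma erdos_c_l2: "x \<in> erdos_c \<Longrightarrow> x \<in> l2"
  by (simp add: erdos_c_def)

lemma erdos_c_coordinate: "x \<in> erdos_c \<Longrightarrow> x i = 0 \<or> (\<exists>m. x i = 1 / real (Suc m))"
proof -
  assume "x \<in> erdos_c"
  then have "x i = 0 \<or> (\<exists>n\<ge>1. x i = 1 / real n)" by (auto simp: erdos_c_def)
  then show ?thesis by (metis One_nat_def Suc_le_D)
qed

lemma sqnorm_nonneg: "y \<in> erdos_c \<Longrightarrow> 0 \<le> sqnorm y"
  using erdos_c_l2 by (intro suminf_nonneg) (auto simp: l2_def)

lemma erdos_cI:
  assumes "x \<in> l2" and "\<And>i. x i = 0 \<or> (\<exists>m. x i = 1 / real (Suc m))"
  shows "x \<in> erdos_c"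
proof -
  have "x i \<in> {0} \<union> {1 / real n |n. n \<ge> 1}" for i
    using assms(2)[of i] by (metis (mono_tags, lifting) UnI1 UnI2 Suc_le_mono One_nat_def insertI1 le0 mem_Collect_eq)
  then show ?thesis using assms(1) by (simp add: erdos_c_def)
qed

text \<open>Either a test identifies the coordinate, and then it does so for both points, or all
  tests below \<open>k\<close> fail and only values up to 1 / (k + 1) remain.\<close>

lemma agree_coordinate_cases:
  assumes "agree k x y" and "i < k" and "x \<in> erdos_c" and "y \<in> erdos_c"
  shows "x i = y i \<or> (0 \<le> x i \<and> x i \<le> 1 / real (Suc k) \<and> 0 \<le> y i \<and> y i \<le> 1 / real (Suc k))"
proof -
  have small: "0 \<le> z i \<and> z i \<le> 1 / real (Suc k)"
    if z: "z \<in> erdos_c" "\<And>m. m < k \<Longrightarrow> z i \<noteq> 1 / real (Suc m)" for z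
  proof (cases "z i = 0")
    case False
    then obtain m where m: "z i = 1 / real (Suc m)" using erdos_c_coordinate[OF z(1), of i] by blast
    then have "k \<le> m" using z(2)[of m] by force
    then show ?thesis unfolding m by (simp add: frac_le)
  qed simp
  show ?thesis
  proof (cases "\<exists>m<k. x i = 1 / real (Suc m)")
    case True
    then show ?thesis using assms(1,2) unfolding agree_def by metis
  next
    case False
    then have "\<not> (\<exists>m<k. y i = 1 / real (Suc m))"
      using assms(1,2) unfolding agree_def by metis
    then show ?thesis using False small[OF assms(3)] small[OF assms(4)] by blast
  qed
qed

text \<open>The Kadec property of the Hilbert norm: coordinatewise convergence becomes norm
  convergence if the norms do not jump up. On an initial segment that carries almost all of the norm
  of \<open>x\<close>, agreement makes \<open>y\<close> nearly equal to \<open>x\<close>; the bound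
  on the norm of \<open>y\<close> then leaves little for its tail.\<close>

lemma agree_imp_close:
  assumes x: "x \<in> erdos_c" and "e > 0"
  shows "\<exists>k. \<forall>y\<in>erdos_c. agree k x y \<and> sqnorm y < sqnorm x + 1 / real (Suc k) \<longrightarrow> l2_dist x y < e"
proof -
  have sx: "summable (\<lambda>i. (x i)\<^sup>2)" using erdos_c_l2[OF x] by (simp add: l2_def)
  have "e\<^sup>2 / 8 > 0" using \<open>e > 0\<close> by simp
  then have "\<forall>\<^sub>F n in sequentially. sqnorm x - e\<^sup>2 / 8 < (\<Sum>i<n. (x i)\<^sup>2)"
    by (intro order_tendstoD(1)[OF summable_LIMSEQ[OF sx]]) simp
  then obtain n where n: "sqnorm x - e\<^sup>2 / 8 < (\<Sum>i<n. (x i)\<^sup>2)"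
    unfolding eventually_sequentially by blast
  \<comment> \<open>With t the tail of \<open>sqnorm x\<close>, the squared distance will be below 4
    * t + (3 * n + 2) * c. The choice of \<open>n\<close> makes the first term less than half of
    \<open>e\<^sup>2\<close>, and \<open>k0\<close> does the same for the second.\<close>
  obtain k0 :: nat where k0: "(3 * real n + 2) / (e\<^sup>2 / 2) < real k0"
    using reals_Archimedean2 by blast
  define k where "k = max n k0"
  define c where "c = 1 / real (Suc k)"
  have "(3 * real n + 2) / (e\<^sup>2 / 2) < real (Suc k)"
    using k0 by (simp add: k_def)
  then have "3 * real n + 2 < real (Suc k) * (e\<^sup>2 / 2)"
    using \<open>e > 0\<close> by (subst (asm) pos_divide_less_eq) auto
  then have k: "(3 * real n + 2) * c < e\<^sup>2 / 2"
    unfolding c_def by (simp add: pos_divide_less_eq mult.commute)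
  have "0 < c" "c \<le> 1" by (auto simp: c_def)
  have "l2_dist x y < e" if y: "y \<in> erdos_c" "agree k x y" "sqnorm y < sqnorm x + c" for y
  proof -
    have sy: "summable (\<lambda>i. (y i)\<^sup>2)" using erdos_c_l2[OF y(1)] by (simp add: l2_def)
    have sd: "summable (\<lambda>i. (x i - y i)\<^sup>2)"
      using l2_diff[OF erdos_c_l2[OF x] erdos_c_l2[OF y(1)]] by (simp add: l2_def)
    \<comment> \<open>Where the coordinates differ, both lie between 0 and \<open>c\<close>, and c
      <= 1 allows \<open>c\<^sup>2\<close> to be replaced by \<open>c\<close>.\<close>
    have co: "(x i - y i)\<^sup>2 \<le> c \<and> (x i)\<^sup>2 \<le> (y i)\<^sup>2 + c" if "i < n" for i
    proof (cases "x i = y i")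
      case False
      then have b: "0 \<le> x i" "x i \<le> c" "0 \<le> y i" "y i \<le> c"
        using agree_coordinate_cases[OF y(2) _ x y(1), of i] \<open>i < n\<close> by (auto simp: k_def c_def)
      have cc: "c\<^sup>2 \<le> c" using \<open>0 < c\<close> \<open>c \<le> 1\<close> by (simp add: power2_eq_square mult_left_le)
      have "(x i)\<^sup>2 \<le> c\<^sup>2" using b by (intro power_mono) auto
      moreover have "\<bar>x i - y i\<bar>\<^sup>2 \<le> c\<^sup>2" using b by (intro power_mono) auto
      ultimately show ?thesis using cc by (auto intro: add_increasing)
    qed (use \<open>0 < c\<close> in simp)
    have "(\<Sum>i<n. (x i - y i)\<^sup>2) \<le> (\<Sum>i<n. c)"
      using co by (intro sum_mono) auto
    then have h1: "(\<Sum>i<n. (x i - y i)\<^sup>2) \<le> n * c" by simp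
    have "(\<Sum>i<n. (x i)\<^sup>2) \<le> (\<Sum>i<n. (y i)\<^sup>2 + c)"
      using co by (intro sum_mono) auto
    then have h2: "(\<Sum>i<n. (x i)\<^sup>2) \<le> (\<Sum>i<n. (y i)\<^sup>2) + n * c" by (simp add: sum.distrib)
    have tx: "sqnorm x = (\<Sum>i. (x (i + n))\<^sup>2) + (\<Sum>i<n. (x i)\<^sup>2)"
      by (rule suminf_split_initial_segment[OF sx])
    have ty: "sqnorm y = (\<Sum>i. (y (i + n))\<^sup>2) + (\<Sum>i<n. (y i)\<^sup>2)"
      by (rule suminf_split_initial_segment[OF sy])
    have td: "sqnorm (\<lambda>i. x i - y i) = (\<Sum>i. (x (i + n) - y (i + n))\<^sup>2) + (\<Sum>i<n. (x i - y i)\<^sup>2)"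
      by (rule suminf_split_initial_segment[OF sd])
    have "(\<Sum>i. (x (i + n) - y (i + n))\<^sup>2) \<le> (\<Sum>i. 2 * (x (i + n))\<^sup>2 + 2 * (y (i + n))\<^sup>2)"
    proof (rule suminf_le)
      show "(x (i + n) - y (i + n))\<^sup>2 \<le> 2 * (x (i + n))\<^sup>2 + 2 * (y (i + n))\<^sup>2" for i
        using zero_le_power2[of "x (i + n) + y (i + n)"] by (simp add: power2_eq_square algebra_simps)
      show "summable (\<lambda>i. (x (i + n) - y (i + n))\<^sup>2)" by (rule summable_ignore_initial_segment[OF sd])
      show "summable (\<lambda>i. 2 * (x (i + n))\<^sup>2 + 2 * (y (i + n))\<^sup>2)"
        by (intro summable_add summable_mult summable_ignore_initial_segment[OF sx] summable_ignore_initial_segment[OF sy])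
    qed
    also have "\<dots> = 2 * (\<Sum>i. (x (i + n))\<^sup>2) + 2 * (\<Sum>i. (y (i + n))\<^sup>2)"
      using summable_ignore_initial_segment[OF sx, of n] summable_ignore_initial_segment[OF sy, of n]
      by (simp add: suminf_add[symmetric] suminf_mult summable_mult)
    finally have "sqnorm (\<lambda>i. x i - y i) \<le>
        2 * (\<Sum>i. (x (i + n))\<^sup>2) + 2 * (\<Sum>i. (y (i + n))\<^sup>2) + n * c"
      using td h1 by linarith
    moreover have "(\<Sum>i. (y (i + n))\<^sup>2) < (\<Sum>i. (x (i + n))\<^sup>2) + c + n * c"
      using tx ty y(3) h2 by linarith
    moreover have "(\<Sum>i. (x (i + n))\<^sup>2) < e\<^sup>2 / 8"
      using tx n by linarith
    ultimately have "sqnorm (\<lambda>i. x i - y i) < e\<^sup>2"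
      using k by (simp add: algebra_simps)
    then show ?thesis
      unfolding l2_dist_def l2_norm_def using \<open>e > 0\<close> by (simp add: real_less_lsqrt)
  qed
  then show ?thesis unfolding c_def by blast
qed

text \<open>The value 1 / (m + 1) is isolated: the nearest other admissible value is 1 / (m + 2), at
  distance 1 / ((m + 1) * (m + 2)), which is at least \<open>d\<close> for all m < k. Norm distance
  dominates coordinate distance.\<close>

lemma close_imp_agree:
  "\<exists>d>0. \<forall>x\<in>erdos_c. \<forall>y\<in>erdos_c. l2_dist x y < d \<longrightarrow> agree k x y"
proof -
  define d where "d = 1 / (real (k + 1) * real (k + 2))"
  have "d > 0" by (simp add: d_def)
  have eq: "y i = x i" if xy: "x i = 1 / real (Suc m)" "m < k" "y \<in> erdos_c" "\<bar>x i - y i\<bar> < d" for x y i m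
  proof -
    have gap: "d \<le> 1 / real (Suc m) - 1 / real (Suc (Suc m))"
    proof -
      have "1 / real (Suc m) - 1 / real (Suc (Suc m)) = 1 / (real (m + 1) * real (m + 2))"
        by (simp add: field_simps)
      also have "d \<le> \<dots>"
        unfolding d_def using xy(2) by (intro divide_left_mono mult_mono mult_pos_pos) auto
      finally show ?thesis .
    qed
    consider "y i = 0" | j where "y i = 1 / real (Suc j)"
      using erdos_c_coordinate[OF xy(3)] by blast
    then show ?thesis
    proof cases
      case 1
      have "0 < 1 / real (Suc (Suc m))" by simp
      then show ?thesis using 1 xy gap by linarith
    next
      case (2 j)
      consider (eq) "j = m" | (gt) "m < j" | (lt) "j < m" by linarith
      then show ?thesis
      proof cases
        case eq
        then show ?thesis using 2 xy by simp
      next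
        case gt
        then have "1 / real (Suc j) \<le> 1 / real (Suc (Suc m))" by (intro divide_left_mono) auto
        then show ?thesis using 2 xy gap by linarith
      next
        case lt
        then have "1 / real m \<le> 1 / real (Suc j)" by (intro divide_left_mono) auto
        moreover have "d \<le> 1 / real m - 1 / real (Suc m)"
        proof -
          have "1 / real m - 1 / real (Suc m) = 1 / (real m * real (m + 1))"
            using lt by (simp add: field_simps)
          also have "d \<le> \<dots>"
            unfolding d_def using lt xy(2) by (intro divide_left_mono mult_mono mult_pos_pos) auto
          finally show ?thesis .
        qed
        ultimately show ?thesis using 2 xy by linarith
      qed
    qed
  qed
  have "agree k x y" if xy: "x \<in> erdos_c" "y \<in> erdos_c" "l2_dist x y < d" for x y
    unfolding agree_def
  proof (intro allI impI)
    fix i m assume "i < k" "m < k"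
    have "\<bar>x i - y i\<bar> < d"
      using l2_dist_coordinate[OF erdos_c_l2[OF xy(1)] erdos_c_l2[OF xy(2)], of i] xy(3) by linarith
    then show "x i = 1 / real (Suc m) \<longleftrightarrow> y i = 1 / real (Suc m)"
      using eq[of x i m y] eq[of y i m x] xy \<open>m < k\<close> by (auto simp: abs_minus_commute)
  qed
  then show ?thesis using \<open>d > 0\<close> by blast
qed

text \<open>The algebra of clopen sets used on the Erdos side: membership is settled by finitely
  many of the tests in \<open>agree\<close>.\<close>

definition cylinder :: "(nat \<Rightarrow> real) set \<Rightarrow> bool" where
  "cylinder Q \<longleftrightarrow> Q \<subseteq> erdos_c \<and>
     (\<exists>k. \<forall>x\<in>erdos_c. \<forall>y\<in>erdos_c. agree k x y \<longrightarrow> (x \<in> Q \<longleftrightarrow> y \<in> Q))"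

lemma cylinder_subset: "cylinder Q \<Longrightarrow> Q \<subseteq> erdos_c"
  by (simp add: cylinder_def)

lemma cylinder_Int_Diff:
  assumes "cylinder P" and "cylinder Q"
  shows "cylinder (P \<inter> Q) \<and> cylinder (P - Q)"
proof -
  obtain k where k: "\<forall>x\<in>erdos_c. \<forall>y\<in>erdos_c. agree k x y \<longrightarrow> (x \<in> P \<longleftrightarrow> y \<in> P)"
    using assms(1) unfolding cylinder_def by blast
  obtain l where l: "\<forall>x\<in>erdos_c. \<forall>y\<in>erdos_c. agree l x y \<longrightarrow> (x \<in> Q \<longleftrightarrow> y \<in> Q)"
    using assms(2) unfolding cylinder_def by blast
  have "(x \<in> P \<longleftrightarrow> y \<in> P) \<and> (x \<in> Q \<longleftrightarrow> y \<in> Q)"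
    if "x \<in> erdos_c" "y \<in> erdos_c" "agree (max k l) x y" for x y
    using k l that agree_mono[OF that(3), of k] agree_mono[OF that(3), of l] by simp
  then show ?thesis
    using assms unfolding cylinder_def by (intro conjI exI[of _ "max k l"]) auto
qed

lemma cylinder_erdos_c: "cylinder erdos_c"
  by (auto simp: cylinder_def)

lemma cylinder_coordinate: "cylinder {x \<in> erdos_c. x i = 1 / real (Suc m)}"
  unfolding cylinder_def by (intro conjI exI[of _ "Suc (max i m)"]) (auto simp: agree_def)

lemma cylinder_agree: "p \<in> erdos_c \<Longrightarrow> cylinder {x \<in> erdos_c. agree k p x}"
  unfolding cylinder_def by (intro conjI exI[of _ k]) (auto simp: agree_def)

lemma finite_support_erdos_c:
  assumes "\<And>i. x i = 0 \<or> (\<exists>m. x i = 1 / real (Suc m))" and "\<And>i. n \<le> i \<Longrightarrow> x i = 0"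
  shows "x \<in> erdos_c" "sqnorm x = (\<Sum>i<n. (x i)\<^sup>2)"
proof -
  have s: "(\<lambda>i. (x i)\<^sup>2) sums (\<Sum>i<n. (x i)\<^sup>2)"
    using assms(2) by (intro sums_finite) auto
  then show "sqnorm x = (\<Sum>i<n. (x i)\<^sup>2)" by (simp add: sums_iff)
  show "x \<in> erdos_c"
    using s by (intro erdos_cI assms(1)) (auto simp: l2_def sums_iff)
qed

text \<open>Tests can pin a non-zero coordinate exactly but only make a zero coordinate small, hence
  the restriction to coordinates where \<open>q\<close> does not vanish.\<close>

lemma agree_initial_segment:
  assumes "\<And>i. q i = 0 \<or> (\<exists>m. q i = 1 / real (Suc m))"
  shows "\<exists>K. \<forall>x. agree K q x \<longrightarrow> (\<forall>i<n. q i \<noteq> 0 \<longrightarrow> x i = q i)"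
proof (induction n)
  case (Suc n)
  then obtain K where K: "\<forall>x. agree K q x \<longrightarrow> (\<forall>i<n. q i \<noteq> 0 \<longrightarrow> x i = q i)" by blast
  obtain m where m: "q n \<noteq> 0 \<longrightarrow> q n = 1 / real (Suc m)" using assms[of n] by blast
  have "x i = q i" if x: "agree (max K (Suc (max m n))) q x" and i: "i < Suc n" "q i \<noteq> 0" for x i
  proof (cases "i = n")
    case True
    then have qn: "q n = 1 / real (Suc m)" using m i by simp
    have "n < max K (Suc (max m n))" "m < max K (Suc (max m n))" by simp_all
    then have "x n = 1 / real (Suc m)" using x qn unfolding agree_def by blast
    then show ?thesis using qn True by simp
  next
    case False
    then show ?thesis using K agree_mono[OF x, of K] i by simp
  qed
  then show ?case by blast
qed simp

text \<open>This is lower semicontinuity of the squared norm over the coordinatewise topology: the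
  non-zero coordinates of \<open>q\<close> are pinned, and all other coordinates can only add to the
  sum.\<close>

lemma agree_initial_segment_sqnorm:
  assumes "\<And>i. q i = 0 \<or> (\<exists>m. q i = 1 / real (Suc m))"
  shows "\<exists>K. \<forall>x\<in>erdos_c. agree K q x \<longrightarrow> (\<Sum>i<n. (q i)\<^sup>2) \<le> sqnorm x"
proof -
  obtain K where K: "\<forall>x. agree K q x \<longrightarrow> (\<forall>i<n. q i \<noteq> 0 \<longrightarrow> x i = q i)"
    using agree_initial_segment[of q n, OF assms] by blast
  have "(\<Sum>i<n. (q i)\<^sup>2) \<le> sqnorm x" if x: "x \<in> erdos_c" "agree K q x" for x
  proof -
    have "(\<Sum>i<n. (q i)\<^sup>2) \<le> (\<Sum>i<n. (x i)\<^sup>2)"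
    proof (rule sum_mono)
      fix i assume "i \<in> {..<n}"
      then show "(q i)\<^sup>2 \<le> (x i)\<^sup>2" using K x(2) by (cases "q i = 0") auto
    qed
    also have "\<dots> \<le> sqnorm x"
      using x(1) erdos_c_l2 by (intro partial_sqnorm_le) auto
    finally show ?thesis .
  qed
  then show ?thesis by blast
qed

text \<open>Truncating a near-minimal point \<open>p0\<close> of \<open>Q\<close> gives \<open>p\<close>; adding \<open>N\<close> further equal coordinates
  with \<open>N / (Suc M0)\<^sup>2\<close> close to \<open>b\<close> gives \<open>q\<close>, which is minimal in the cylinder around it.\<close>

lemma splitting_erdos_c: "splitting {Q. cylinder Q} sqnorm"
  unfolding splitting_def
proof (intro ballI allI impI)
  fix Q and b e :: real
  assume "Q \<in> {Q. cylinder Q}" and "Q \<noteq> {}" and "b \<ge> 0" and "e > 0"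
  then have "cylinder Q" by simp
  then have Q: "Q \<subseteq> erdos_c" by (simp add: cylinder_def)
  obtain k where k: "\<forall>x\<in>erdos_c. \<forall>y\<in>erdos_c. agree k x y \<longrightarrow> (x \<in> Q \<longleftrightarrow> y \<in> Q)"
    using \<open>cylinder Q\<close> unfolding cylinder_def by blast
  have nonneg: "0 \<le> sqnorm x" if "x \<in> Q" for x
    using that Q sqnorm_nonneg by blast
  have bdd: "bdd_below (sqnorm ` S)" if "S \<subseteq> Q" for S
    using that nonneg by (intro bdd_below_nonneg_image) auto
  define v where "v = Inf (sqnorm ` Q)"
  have "\<exists>p\<in>Q. sqnorm p < v + e / 2"
    using cInf_lessD[of "sqnorm ` Q" "v + e / 2"] \<open>Q \<noteq> {}\<close> \<open>e > 0\<close> by (auto simp: v_def)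
  then obtain p0 where p0: "p0 \<in> Q" "sqnorm p0 < v + e / 2" by blast
  define p where "p i = (if i < k then p0 i else 0)" for i
  have p0E: "p0 \<in> erdos_c" using p0 Q by blast
  have p_cases: "p i = 0 \<or> (\<exists>m. p i = 1 / real (Suc m))" for i
    using erdos_c_coordinate[OF p0E, of i] by (simp add: p_def)
  have p: "p \<in> erdos_c" "sqnorm p = (\<Sum>i<k. (p i)\<^sup>2)"
    using finite_support_erdos_c[of p k, OF p_cases] by (simp_all add: p_def)
  have "agree k p0 p" by (simp add: agree_def p_def)
  then have "p \<in> Q" using k p0 p0E p by blast
  have "(\<Sum>i<k. (p i)\<^sup>2) \<le> sqnorm p0"
    using partial_sqnorm_le[OF erdos_c_l2[OF p0E], of k] by (simp add: p_def)
  then have p_less: "sqnorm p < v + e / 2" using p p0 by simp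
  have v_le: "v \<le> sqnorm x" if "x \<in> Q" for x
    unfolding v_def using bdd[of Q] that by (intro cInf_lower) auto
  \<comment> \<open>\<open>s\<close> is the contribution of one additional coordinate, that is, the
    step in which the infimum can be raised. The choice of \<open>M0\<close> makes it smaller than
    \<open>e / 4\<close>.\<close>
  obtain M0 :: nat where M0: "4 / e < real M0" using reals_Archimedean2 by blast
  define s where "s = 1 / (real (Suc M0))\<^sup>2"
  have "s > 0" by (simp add: s_def)
  have "2 * s < e / 2"
  proof -
    have "4 / e < real (Suc M0)" using M0 by simp
    then have "4 < real (Suc M0) * e" using \<open>e > 0\<close> by (simp add: pos_divide_less_eq)
    also have "\<dots> \<le> (real (Suc M0))\<^sup>2 * e"
      using \<open>e > 0\<close> by (intro mult_right_mono self_le_power) auto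
    finally have "4 < (real (Suc M0))\<^sup>2 * e" .
    then have "4 * s < e" unfolding s_def by (simp add: pos_divide_less_eq mult.commute)
    then show ?thesis by simp
  qed
  \<comment> \<open>\<open>N\<close> is the least number of steps that exceeds \<open>b\<close>, so
    the overshoot is at most \<open>s\<close>. It is positive even for b = 0, which makes
    \<open>q\<close> differ from \<open>p\<close> at coordinate \<open>k\<close> and keeps
    \<open>p\<close> out of \<open>B\<close>.\<close>
  define N where "N = Suc (nat \<lfloor>b / s\<rfloor>)"
  have "N > 0" by (simp add: N_def)
  have N: "b < real N * s" "real N * s \<le> b + s"
  proof -
    have "0 \<le> b / s" using \<open>b \<ge> 0\<close> \<open>s > 0\<close> by simp
    then have "b / s < real N" "real N \<le> b / s + 1" unfolding N_def by linarith+
    then show "b < real N * s" "real N * s \<le> b + s"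
      using \<open>s > 0\<close> by (simp_all add: field_simps)
  qed
  define q where "q i = (if i < k then p0 i else if i < k + N then 1 / real (Suc M0) else 0)" for i
  have q_cases: "q i = 0 \<or> (\<exists>m. q i = 1 / real (Suc m))" for i
    using erdos_c_coordinate[OF p0E, of i] by (auto simp: q_def)
  have q: "q \<in> erdos_c" "sqnorm q = (\<Sum>i<k + N. (q i)\<^sup>2)"
    using finite_support_erdos_c[of q "k + N", OF q_cases] by (simp_all add: q_def)
  have "agree k p0 q" by (simp add: agree_def q_def)
  then have "q \<in> Q" using k p0 p0E q by blast
  have "(\<Sum>i<k + N. (q i)\<^sup>2) = (\<Sum>i<k. (q i)\<^sup>2) + (\<Sum>i=k..<k + N. (q i)\<^sup>2)"
    using sum.atLeastLessThan_concat[of 0 k "k + N" "\<lambda>i. (q i)\<^sup>2"] by (simp add: atLeast0LessThan)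
  also have "(\<Sum>i=k..<k + N. (q i)\<^sup>2) = (\<Sum>i=k..<k + N. s)"
    by (intro sum.cong) (auto simp: q_def s_def power_divide)
  also have "(\<Sum>i<k. (q i)\<^sup>2) = (\<Sum>i<k. (p i)\<^sup>2)"
    by (intro sum.cong) (auto simp: q_def p_def)
  finally have sq: "sqnorm q = sqnorm p + real N * s" using q p by simp
  obtain K where K: "\<forall>x. agree K q x \<longrightarrow> (\<forall>i<k + N. q i \<noteq> 0 \<longrightarrow> x i = q i)"
    using agree_initial_segment[of q "k + N", OF q_cases] by blast
  define B where "B = Q \<inter> {x \<in> erdos_c. agree K q x}"
  have "cylinder B"
    unfolding B_def using cylinder_Int_Diff[OF \<open>cylinder Q\<close> cylinder_agree[OF q(1)]] by blast
  have Bq: "x i = q i" if "x \<in> B" "i < k + N" "q i \<noteq> 0" for x i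
    using that K by (simp add: B_def)
  have "q \<in> B" using \<open>q \<in> Q\<close> q by (simp add: B_def agree_def)
  have q_min: "sqnorm q \<le> sqnorm x" if x: "x \<in> B" for x
  proof -
    have "(\<Sum>i<k + N. (q i)\<^sup>2) \<le> (\<Sum>i<k + N. (x i)\<^sup>2)"
    proof (rule sum_mono)
      fix i assume "i \<in> {..<k + N}"
      then show "(q i)\<^sup>2 \<le> (x i)\<^sup>2" using Bq[OF x, of i] by (cases "q i = 0") auto
    qed
    also have "\<dots> \<le> sqnorm x"
      using x Q erdos_c_l2 by (intro partial_sqnorm_le) (auto simp: B_def)
    finally show ?thesis using q by simp
  qed
  have "p \<notin> B"
  proof
    assume "p \<in> B"
    then have "p k = q k" using \<open>N > 0\<close> by (intro Bq) (auto simp: q_def)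
    then show False using \<open>N > 0\<close> by (simp add: p_def q_def)
  qed
  have "Inf (sqnorm ` B) = sqnorm q"
    using \<open>q \<in> B\<close> q_min by (intro cInf_eq_minimum) auto
  then have "\<bar>Inf (sqnorm ` B) - (Inf (sqnorm ` Q) + b)\<bar> < e"
    using sq N v_le[OF \<open>p \<in> Q\<close>] p_less \<open>2 * s < e / 2\<close> \<open>s > 0\<close> unfolding v_def[symmetric] by linarith
  moreover have "\<bar>Inf (sqnorm ` (Q - B)) - Inf (sqnorm ` Q)\<bar> < e"
  proof -
    have "Inf (sqnorm ` (Q - B)) \<le> sqnorm p"
      using \<open>p \<in> Q\<close> \<open>p \<notin> B\<close> bdd[of "Q - B"] by (intro cInf_lower) auto
    moreover have "v \<le> Inf (sqnorm ` (Q - B))"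
      using \<open>p \<in> Q\<close> \<open>p \<notin> B\<close> v_le by (intro cInf_greatest) auto
    ultimately show ?thesis using p_less \<open>e > 0\<close> unfolding v_def[symmetric] by linarith
  qed
  moreover have "B \<subseteq> Q" by (auto simp: B_def)
  moreover have "B \<noteq> {}" "Q - B \<noteq> {}" using \<open>q \<in> B\<close> \<open>p \<in> Q\<close> \<open>p \<notin> B\<close> by auto
  ultimately show "\<exists>B\<in>{Q. cylinder Q}. B \<subseteq> Q \<and> B \<noteq> {} \<and> Q - B \<noteq> {} \<and>
    \<bar>Inf (sqnorm ` B) - (Inf (sqnorm ` Q) + b)\<bar> < e \<and> \<bar>Inf (sqnorm ` (Q - B)) - Inf (sqnorm ` Q)\<bar> < e"
    using \<open>cylinder B\<close> by (intro bexI[of _ B]) simp_all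
qed

lemma splitting_algebra_erdos_c: "splitting_algebra erdos_c {Q. cylinder Q} sqnorm"
proof -
  have "(\<lambda>i. 0) \<in> erdos_c" using finite_support_erdos_c(1)[of "\<lambda>i. 0" 0] by simp
  then show ?thesis
    unfolding splitting_algebra_def
    using sqnorm_nonneg splitting_erdos_c cylinder_erdos_c cylinder_Int_Diff cylinder_subset by auto
qed

section \<open>The embedding\<close>

lemma small_power: "(0::real) < e \<Longrightarrow> \<exists>n\<ge>k. c * (1/2)^n < e"
proof -
  assume "0 < e"
  have "(\<lambda>n. c * (1/2)^n) \<longlonglongrightarrow> c * 0"
    by (intro tendsto_mult tendsto_const LIMSEQ_power_zero) simp
  then have "\<forall>\<^sub>F n in sequentially. c * (1/2)^n < e"
    using order_tendstoD(2)[of "\<lambda>n. c * (1/2)^n" 0 sequentially e] \<open>0 < e\<close> by simp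
  then obtain N where "\<forall>n\<ge>N. c * (1/2)^n < e" by (auto simp: eventually_sequentially)
  then show ?thesis by (intro exI[of _ "max k N"]) auto
qed

text \<open>If \<open>f\<close> skipped an interval above its infimum on \<open>A\<close>, a strict sublevel set would be clopen,
  non-empty and bounded.\<close>

lemma (in witness_topology) splitting_clopen:
  assumes cont: "continuous_map X euclideanreal f" and lsc: "lsc f"
    and nonneg: "\<And>x. x \<in> topspace X \<Longrightarrow> 0 \<le> f x"
    and unbounded: "\<And>C t. clopenin X C \<Longrightarrow> C \<noteq> {} \<Longrightarrow> \<exists>x\<in>C. t < f x"
  shows "splitting {C. clopenin X C} f"
  unfolding splitting_def
proof (intro ballI allI impI)
  fix A and b e :: real
  assume "A \<in> {C. clopenin X C}" and "A \<noteq> {}" and "b \<ge> 0" and "e > 0"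
  then have A: "clopenin X A" by simp
  have AX: "A \<subseteq> topspace X" using A openin_subset[of X A] by (simp add: clopenin_def)
  have bdd: "bdd_below (f ` S)" if "S \<subseteq> A" for S
    using that nonneg AX by (intro bdd_below_nonneg_image) auto
  define v where "v = Inf (f ` A)"
  have v_le: "v \<le> f x" if "x \<in> A" for x
    unfolding v_def using bdd[of A] that by (intro cInf_lower) auto
  define d where "d = e / 4"
  have "d > 0" using \<open>e > 0\<close> by (simp add: d_def)
  obtain p where p: "p \<in> A" "f p < v + d"
    using cInf_lessD[of "f ` A" "v + d"] \<open>A \<noteq> {}\<close> \<open>d > 0\<close> by (auto simp: v_def)
  \<comment> \<open>As b >= 0, \<open>s\<close> lies above \<open>f p\<close>. Hence
    \<open>p\<close> will stay outside \<open>B\<close>, where all values exceed \<open>s\<close>,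
    and a point \<open>q\<close> with value between \<open>s\<close> and \<open>s + d\<close> will
    bound the infimum of \<open>B\<close> from above.\<close>
  define s where "s = v + b + d"
  have "f p < s" using p(2) \<open>b \<ge> 0\<close> by (simp add: s_def)
  have lower: "openin X {x \<in> topspace X. f x < c}" for c
    using cont by (simp add: continuous_map_upper_lower_semicontinuous_lt)
  have upper: "closedin X {x \<in> topspace X. f x \<le> c}" for c
    using cont by (simp add: continuous_map_upper_lower_semicontinuous_le)
  have "\<exists>q\<in>A. s < f q \<and> f q < s + d"
  proof (rule ccontr)
    assume no: "\<not> (\<exists>q\<in>A. s < f q \<and> f q < s + d)"
    define D where "D = A \<inter> {x \<in> topspace X. f x < s + d}"
    have "D = A \<inter> {x \<in> topspace X. f x \<le> s}"
      using no \<open>d > 0\<close> by (force simp: D_def)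
    then have "clopenin X D"
      using A lower upper unfolding clopenin_def by (metis D_def closedin_Int openin_Int)
    moreover have "p \<in> D" using p AX \<open>f p < s\<close> \<open>d > 0\<close> by (auto simp: D_def)
    ultimately obtain x where "x \<in> D" "s + d < f x" using unbounded by blast
    then show False by (simp add: D_def)
  qed
  then obtain q where q: "q \<in> A" "s < f q" "f q < s + d" by blast
  \<comment> \<open>The set where \<open>f\<close> exceeds \<open>s\<close> is in general only open,
    but lower semicontinuity over \<open>T\<close> puts a clopen neighbourhood of \<open>q\<close>
    inside it.\<close>
  have "openin T {x \<in> topspace X. s < f x}" "q \<in> {x \<in> topspace X. s < f x}"
    using lsc q AX by (auto simp: lsc_def)
  then obtain S where S: "S \<in> Z" "q \<in> S" "S \<subseteq> {x \<in> topspace X. s < f x}"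
    using Z_base by meson
  define B where "B = A \<inter> S"
  have "clopenin X S" using Z_clopen[OF S(1)] coarser closedin_coarser by (simp add: clopenin_def)
  then have "clopenin X B" unfolding B_def by (rule clopenin_Int[OF A])
  have "q \<in> B" "p \<in> A - B" using q S p \<open>f p < s\<close> by (auto simp: B_def)
  have "Inf (f ` B) \<le> f q" using \<open>q \<in> B\<close> bdd[of B] by (intro cInf_lower) (auto simp: B_def)
  moreover have "s \<le> Inf (f ` B)" using \<open>q \<in> B\<close> S(3) by (intro cInf_greatest) (auto simp: B_def)
  ultimately have "\<bar>Inf (f ` B) - (Inf (f ` A) + b)\<bar> < e"
    using q(3) \<open>d > 0\<close> unfolding s_def v_def[symmetric] d_def by linarith
  moreover have "\<bar>Inf (f ` (A - B)) - Inf (f ` A)\<bar> < e"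
  proof -
    have "Inf (f ` (A - B)) \<le> f p" using \<open>p \<in> A - B\<close> bdd[of "A - B"] by (intro cInf_lower) auto
    moreover have "v \<le> Inf (f ` (A - B))" using \<open>p \<in> A - B\<close> v_le by (intro cInf_greatest) auto
    ultimately show ?thesis using p(2) \<open>d > 0\<close> unfolding v_def[symmetric] d_def by linarith
  qed
  moreover have "B \<subseteq> A" "B \<noteq> {}" "A - B \<noteq> {}" using \<open>q \<in> B\<close> \<open>p \<in> A - B\<close> by (auto simp: B_def)
  ultimately show "\<exists>B\<in>{C. clopenin X C}. B \<subseteq> A \<and> B \<noteq> {} \<and> A - B \<noteq> {} \<and>
    \<bar>Inf (f ` B) - (Inf (f ` A) + b)\<bar> < e \<and> \<bar>Inf (f ` (A - B)) - Inf (f ` A)\<bar> < e"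
    using \<open>clopenin X B\<close> by (intro bexI[of _ B]) simp_all
qed

section \<open>The limit of a sequence of matched partitions\<close>

definition coordinate_set :: "nat \<Rightarrow> nat \<Rightarrow> (nat \<Rightarrow> real) set" where
  "coordinate_set i m = {x \<in> erdos_c. x i = 1 / real (Suc m)}"

text \<open>The witness topology survives only through the sequence \<open>A\<close>:
  \<open>f_lsc\<close> is lower semicontinuity of \<open>f\<close> over the topology that
  \<open>A\<close> generates, and \<open>f_base\<close> says that \<open>A\<close> and the strict
  sublevel sets of \<open>f\<close> together give neighbourhood bases in \<open>X\<close>.\<close>

locale matched_pieces =
  fixes X :: "'a topology" and f :: "'a \<Rightarrow> real" and A :: "nat \<Rightarrow> 'a set"
    and R :: "nat \<Rightarrow> ('a set \<times> (nat \<Rightarrow> real) set) set"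
  assumes f_continuous: "continuous_map X euclideanreal f"
    and f_nonneg: "\<And>x. x \<in> topspace X \<Longrightarrow> 0 \<le> f x"
    and f_unbounded: "\<And>C t. clopenin X C \<Longrightarrow> C \<noteq> {} \<Longrightarrow> \<exists>x\<in>C. t < f x"
    and f_lsc: "\<And>x c. x \<in> topspace X \<Longrightarrow> c < f x \<Longrightarrow> \<exists>n. x \<in> A n \<and> (\<forall>y\<in>A n. c < f y)"
    and f_base: "\<And>U x. openin X U \<Longrightarrow> x \<in> U \<Longrightarrow> \<exists>n. \<exists>\<delta>>0. x \<in> A n \<and> (\<forall>y\<in>A n. f y < f x + \<delta> \<longrightarrow> y \<in> U)"
    and R_0: "R 0 = {(topspace X, erdos_c)}"
    and R_matching: "\<And>n. matching (topspace X) erdos_c (R n)"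
    and R_clopen: "\<And>n r. r \<in> R n \<Longrightarrow> clopenin X (fst r) \<and> cylinder (snd r)"
    and R_refines: "\<And>n. refines f sqnorm ((1/2)^n) (R n) (R (Suc n))"
    and R_decides: "\<And>n. decides (A n) (fst ` R (Suc n))"
    and R_decides': "\<And>i m. decides (coordinate_set i m) (snd ` R (Suc (prod_encode (i, m))))"
begin

definition piece :: "nat \<Rightarrow> 'a \<Rightarrow> 'a set \<times> (nat \<Rightarrow> real) set" where
  "piece n x = (SOME r. r \<in> R n \<and> x \<in> fst r)"

abbreviation "dom_piece n x \<equiv> fst (piece n x)"
abbreviation "cod_piece n x \<equiv> snd (piece n x)"

lemma piece: "x \<in> topspace X \<Longrightarrow> piece n x \<in> R n \<and> x \<in> dom_piece n x"
proof -
  assume "x \<in> topspace X"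
  moreover have "(\<Union>r\<in>R n. fst r) = topspace X" using R_matching[of n] by (simp add: matching_def)
  ultimately have "\<exists>r. r \<in> R n \<and> x \<in> fst r" by blast
  then show ?thesis unfolding piece_def by (rule someI_ex)
qed

lemma piece_eqI: "r \<in> R n \<Longrightarrow> x \<in> fst r \<Longrightarrow> piece n x = r"
proof (rule ccontr)
  assume r: "r \<in> R n" "x \<in> fst r" "piece n x \<noteq> r"
  have "x \<in> topspace X" using matching_piece[OF R_matching r(1)] r(2) by blast
  then show False using matching_disjoint[OF R_matching _ r(1) r(3)] piece r(2) by blast
qed

lemma piece_eqI':
  assumes "r \<in> R n" "y \<in> snd r" "x \<in> topspace X" "y \<in> cod_piece n x"
  shows "piece n x = r"
  using matching_disjoint[OF R_matching _ assms(1), of "piece n x"] piece[OF assms(3)] assms by blast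

lemma dom_piece_eq: "x \<in> topspace X \<Longrightarrow> y \<in> dom_piece n x \<Longrightarrow> piece n y = piece n x"
  using piece by (intro piece_eqI) auto

lemma cod_piece_subset: "x \<in> topspace X \<Longrightarrow> cod_piece n x \<subseteq> erdos_c \<and> cod_piece n x \<noteq> {}"
  using matching_piece[OF R_matching, of "piece n x"] piece by blast

lemma dom_piece_subset: "x \<in> topspace X \<Longrightarrow> dom_piece n x \<subseteq> topspace X"
  using matching_piece[OF R_matching, of "piece n x"] piece by blast

lemma piece_Suc:
  assumes "x \<in> topspace X"
  shows "dom_piece (Suc n) x \<subseteq> dom_piece n x" "cod_piece (Suc n) x \<subseteq> cod_piece n x"
    "\<bar>defect f sqnorm (piece (Suc n) x) - defect f sqnorm (piece n x)\<bar> < (1/2)^n"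
proof -
  have "piece (Suc n) x \<in> R (Suc n)" "x \<in> dom_piece (Suc n) x" using piece[OF assms] by blast+
  then obtain r where r: "r \<in> R n" "dom_piece (Suc n) x \<subseteq> fst r" "cod_piece (Suc n) x \<subseteq> snd r"
    "\<bar>defect f sqnorm (piece (Suc n) x) - defect f sqnorm r\<bar> < (1/2)^n"
    using R_refines[of n] unfolding refines_def by meson
  have "piece n x = r"
    using r(1,2) \<open>x \<in> dom_piece (Suc n) x\<close> by (intro piece_eqI) auto
  then show "dom_piece (Suc n) x \<subseteq> dom_piece n x" "cod_piece (Suc n) x \<subseteq> cod_piece n x"
    "\<bar>defect f sqnorm (piece (Suc n) x) - defect f sqnorm (piece n x)\<bar> < (1/2)^n"
    using r by simp_all
qed

lemma piece_mono:
  assumes "x \<in> topspace X" and "m \<le> n"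
  shows "dom_piece n x \<subseteq> dom_piece m x" "cod_piece n x \<subseteq> cod_piece m x"
  using lift_Suc_antimono_le[of "\<lambda>n. dom_piece n x", OF piece_Suc(1)[OF assms(1)] assms(2)]
    lift_Suc_antimono_le[of "\<lambda>n. cod_piece n x", OF piece_Suc(2)[OF assms(1)] assms(2)] by simp_all

abbreviation "gap n x \<equiv> defect f sqnorm (piece n x)"

lemma gap_diff:
  assumes "x \<in> topspace X" and "n \<le> m"
  shows "\<bar>gap m x - gap n x\<bar> \<le> 2 * (1/2)^n"
proof -
  \<comment> \<open>The right-hand side is the geometric sum of the errors (1/2)^i for n <= i < n +
    k.\<close>
  have "\<bar>gap (n + k) x - gap n x\<bar> \<le> 2 * (1/2)^n - 2 * (1/2)^(n + k)" for k
  proof (induction k)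
    case (Suc k)
    have "2 * (1/2::real)^(n + Suc k) = (1/2)^(n + k)" by simp
    then show ?case using Suc piece_Suc(3)[OF assms(1), of "n + k"] by (simp only: add_Suc_right)
  qed simp
  from this[of "m - n"] have "\<bar>gap m x - gap n x\<bar> \<le> 2 * (1/2)^n - 2 * (1/2)^m"
    using assms(2) by simp
  moreover have "0 \<le> (1/2::real)^m" by simp
  ultimately show ?thesis by linarith
qed

definition u :: "'a \<Rightarrow> real" where
  "u x = lim (\<lambda>n. gap n x)"

lemma u_limit:
  assumes "x \<in> topspace X"
  shows "(\<lambda>n. gap n x) \<longlonglongrightarrow> u x"
proof -
  have "Cauchy (\<lambda>n. gap n x)"
  proof (rule metric_CauchyI)
    fix e :: real assume "0 < e"
    then obtain N where N: "4 * (1/2)^N < e" using small_power by blast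
    have "dist (gap m x) (gap n x) < e" if "m \<ge> N" "n \<ge> N" for m n
      using gap_diff[OF assms that(1)] gap_diff[OF assms that(2)] N by (simp only: dist_real_def)
    then show "\<exists>M. \<forall>m\<ge>M. \<forall>n\<ge>M. dist (gap m x) (gap n x) < e" by blast
  qed
  then show ?thesis
    unfolding u_def using Cauchy_convergent convergent_LIMSEQ_iff by blast
qed

lemma u_gap:
  assumes "x \<in> topspace X"
  shows "\<bar>u x - gap n x\<bar> \<le> 2 * (1/2)^n"
proof (rule LIMSEQ_le_const2)
  show "(\<lambda>m. \<bar>gap m x - gap n x\<bar>) \<longlonglongrightarrow> \<bar>u x - gap n x\<bar>"
    by (intro tendsto_intros u_limit assms)
  show "\<exists>N. \<forall>m\<ge>N. \<bar>gap m x - gap n x\<bar> \<le> 2 * (1/2)^n"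
    using gap_diff[OF assms] by blast
qed

text \<open>Two points of one piece of stage \<open>n\<close> share its defect, from which each
  value of \<open>u\<close> differs by at most 2 * (1/2)^n. So \<open>u\<close> is continuous, even
  for the topology generated by the pieces.\<close>

lemma u_close:
  assumes "x \<in> topspace X" and "y \<in> dom_piece n x"
  shows "\<bar>u y - u x\<bar> \<le> 4 * (1/2)^n"
proof -
  have "y \<in> topspace X" using assms dom_piece_subset by blast
  then show ?thesis
    using u_gap[OF assms(1), of n] u_gap[of y n] dom_piece_eq[OF assms] by simp
qed

lemma bdd_below_f: "x \<in> topspace X \<Longrightarrow> bdd_below (f ` dom_piece n x)"
  using f_nonneg dom_piece_subset by (intro bdd_below_nonneg_image) blast

lemma bdd_below_sqnorm: "x \<in> topspace X \<Longrightarrow> bdd_below (sqnorm ` cod_piece n x)"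
  using sqnorm_nonneg cod_piece_subset by (intro bdd_below_nonneg_image) blast

lemma dom_piece_decided:
  assumes "x \<in> A n" and "x \<in> topspace X" and "n < m"
  shows "dom_piece m x \<subseteq> A n"
proof -
  have "dom_piece (Suc n) x \<subseteq> A n \<or> dom_piece (Suc n) x \<inter> A n = {}"
    using R_decides[of n] piece[OF assms(2), of "Suc n"] unfolding decides_def by blast
  then have "dom_piece (Suc n) x \<subseteq> A n" using piece[OF assms(2), of "Suc n"] assms(1) by blast
  then show ?thesis using piece_mono(1)[OF assms(2), of "Suc n" m] assms(3) by auto
qed

text \<open>The infima of \<open>f\<close> tend to \<open>f x\<close>: they never exceed it because
  \<open>x\<close> lies in each piece, and by lower semicontinuity they pass every smaller bound
  once the pieces lie in a suitable \<open>A n\<close>. Subtracting the gaps gives the infima on the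
  Erdos side.\<close>

lemma Inf_sqnorm_limit:
  assumes x: "x \<in> topspace X"
  shows "(\<lambda>n. Inf (sqnorm ` cod_piece n x)) \<longlonglongrightarrow> f x - u x"
proof -
  have "(\<lambda>n. Inf (f ` dom_piece n x)) \<longlonglongrightarrow> f x"
  proof (rule order_tendstoI)
    fix c assume "c < f x"
    then obtain c' where c': "c < c'" "c' < f x" using dense by blast
    obtain n where n: "x \<in> A n" "\<forall>y\<in>A n. c' < f y" using f_lsc[OF x c'(2)] by blast
    have "c < Inf (f ` dom_piece m x)" if "m > n" for m
    proof -
      have "c' \<le> Inf (f ` dom_piece m x)"
        using dom_piece_decided[OF n(1) x that] n(2) piece[OF x, of m] by (intro cInf_greatest) (auto intro: less_imp_le)
      then show ?thesis using c' by simp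
    qed
    then show "\<forall>\<^sub>F m in sequentially. c < Inf (f ` dom_piece m x)"
      using eventually_gt_at_top[of n] by (rule eventually_mono[rotated])
  next
    fix c assume "f x < c"
    moreover have "Inf (f ` dom_piece m x) \<le> f x" for m
      using piece[OF x] bdd_below_f[OF x] by (intro cInf_lower) auto
    ultimately show "\<forall>\<^sub>F m in sequentially. Inf (f ` dom_piece m x) < c"
      by (intro always_eventually allI) (auto intro: le_less_trans)
  qed
  then have "(\<lambda>n. Inf (f ` dom_piece n x) - gap n x) \<longlonglongrightarrow> f x - u x"
    by (intro tendsto_diff u_limit x)
  then show ?thesis by (simp add: defect_def)
qed

text \<open>The coordinatewise limit of the pieces \<open>cod_piece n x\<close>: each test is
  decided at some stage, and a coordinate that fails all its tests must be 0. That this limit is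
  square-summable and lies in the pieces is a separate matter, since nested cylinders alone can
  shrink towards a sequence outside \<open>l2\<close>.\<close>

definition embed :: "'a \<Rightarrow> nat \<Rightarrow> real" where
  "embed x i = (if \<exists>m n. cod_piece n x \<subseteq> coordinate_set i m
     then 1 / real (Suc (SOME m. \<exists>n. cod_piece n x \<subseteq> coordinate_set i m)) else 0)"

lemma embed_values: "embed x i = 0 \<or> (\<exists>m. embed x i = 1 / real (Suc m))"
  unfolding embed_def by metis

lemma embed_iff:
  assumes x: "x \<in> topspace X"
  shows "embed x i = 1 / real (Suc m) \<longleftrightarrow> (\<exists>n. cod_piece n x \<subseteq> coordinate_set i m)"
proof -
  have uniq: "m = m'" if mm: "cod_piece n x \<subseteq> coordinate_set i m" "cod_piece n' x \<subseteq> coordinate_set i m'" for m m' n n'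
  proof -
    obtain z where "z \<in> cod_piece (max n n') x" using cod_piece_subset[OF x] by blast
    then have "z \<in> coordinate_set i m" "z \<in> coordinate_set i m'"
      using mm piece_mono(2)[OF x, of n "max n n'"] piece_mono(2)[OF x, of n' "max n n'"] by auto
    then show ?thesis by (simp add: coordinate_set_def)
  qed
  show ?thesis
  proof
    assume e: "embed x i = 1 / real (Suc m)"
    then have ex: "\<exists>m n. cod_piece n x \<subseteq> coordinate_set i m" by (auto simp: embed_def split: if_splits)
    then have "\<exists>n. cod_piece n x \<subseteq> coordinate_set i (SOME m. \<exists>n. cod_piece n x \<subseteq> coordinate_set i m)"
      by (rule someI_ex)
    moreover have "(SOME m. \<exists>n. cod_piece n x \<subseteq> coordinate_set i m) = m"
      using e ex by (simp add: embed_def)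
    ultimately show "\<exists>n. cod_piece n x \<subseteq> coordinate_set i m" by simp
  next
    assume ex: "\<exists>n. cod_piece n x \<subseteq> coordinate_set i m"
    then have "(SOME m. \<exists>n. cod_piece n x \<subseteq> coordinate_set i m) = m"
      using uniq by (intro some_equality) blast+
    then show "embed x i = 1 / real (Suc m)" using ex by (auto simp: embed_def)
  qed
qed

lemma cod_piece_decided:
  assumes x: "x \<in> topspace X" and n: "prod_encode (i, m) < n" and z: "z \<in> cod_piece n x"
  shows "embed x i = 1 / real (Suc m) \<longleftrightarrow> z i = 1 / real (Suc m)"
proof -
  let ?N = "Suc (prod_encode (i, m))"
  have dec: "cod_piece ?N x \<subseteq> coordinate_set i m \<or> cod_piece ?N x \<inter> coordinate_set i m = {}"
    using R_decides'[of i m] piece[OF x, of ?N] unfolding decides_def by blast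
  have zE: "z \<in> erdos_c" using cod_piece_subset[OF x] z by blast
  have zN: "z \<in> cod_piece ?N x" using piece_mono(2)[OF x, of ?N n] n z by auto
  show ?thesis
  proof
    assume "embed x i = 1 / real (Suc m)"
    then obtain k where k: "cod_piece k x \<subseteq> coordinate_set i m" using embed_iff[OF x] by blast
    obtain w where "w \<in> cod_piece (max k ?N) x" using cod_piece_subset[OF x] by blast
    then have "w \<in> cod_piece ?N x \<inter> coordinate_set i m"
      using k piece_mono(2)[OF x, of k "max k ?N"] piece_mono(2)[OF x, of ?N "max k ?N"] by auto
    then have "z \<in> coordinate_set i m" using dec zN by blast
    then show "z i = 1 / real (Suc m)" by (simp add: coordinate_set_def)
  next
    assume "z i = 1 / real (Suc m)"
    then have "z \<in> coordinate_set i m" using zE by (simp add: coordinate_set_def)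
    then have "cod_piece ?N x \<subseteq> coordinate_set i m" using dec zN by blast
    then show "embed x i = 1 / real (Suc m)" using embed_iff[OF x] by blast
  qed
qed

text \<open>The tests are enumerated in advance, so the stage that settles the first ones is the
  same for all points. This uniformity matters in \<open>embed_dense\<close>, where the stage is
  fixed before the point of \<open>X\<close> is found.\<close>

lemma cod_piece_agree:
  "\<exists>N. \<forall>n\<ge>N. \<forall>x\<in>topspace X. \<forall>z\<in>cod_piece n x. agree k (embed x) z"
proof -
  \<comment> \<open>The inserted 0 covers k = 0, where \<open>Max\<close> would otherwise be taken
    over the empty set.\<close>
  define N where "N = Suc (Max (insert 0 (prod_encode ` ({..<k} \<times> {..<k}))))"
  have "prod_encode (i, m) < n" if "i < k" "m < k" "N \<le> n" for i m n
  proof -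
    have "prod_encode (i, m) \<le> Max (insert 0 (prod_encode ` ({..<k} \<times> {..<k})))"
      using that by (intro Max_ge) auto
    then show ?thesis using that(3) by (simp add: N_def)
  qed
  then show ?thesis
    using cod_piece_decided unfolding agree_def by (intro exI[of _ N]) blast
qed

text \<open>At late stages the non-zero coordinates of \<open>embed x\<close> below \<open>k\<close>
  are shared by all points of the piece, so the partial sum is a lower bound for the infimum of
  \<open>sqnorm\<close> there; the bound passes to the limit. Square-summability of
  \<open>embed x\<close> follows.\<close>

lemma embed_partial_sqnorm:
  assumes x: "x \<in> topspace X"
  shows "(\<Sum>i<k. (embed x i)\<^sup>2) \<le> f x - u x"
proof -
  obtain K where K: "\<forall>z\<in>erdos_c. agree K (embed x) z \<longrightarrow> (\<Sum>i<k. (embed x i)\<^sup>2) \<le> sqnorm z"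
    using agree_initial_segment_sqnorm[of "embed x" k, OF embed_values] by blast
  obtain N where N: "\<forall>n\<ge>N. \<forall>x\<in>topspace X. \<forall>z\<in>cod_piece n x. agree K (embed x) z"
    using cod_piece_agree by blast
  have "(\<Sum>i<k. (embed x i)\<^sup>2) \<le> Inf (sqnorm ` cod_piece n x)" if "n \<ge> N" for n
  proof (rule cInf_greatest)
    show "sqnorm ` cod_piece n x \<noteq> {}" using cod_piece_subset[OF x] by blast
    fix t assume "t \<in> sqnorm ` cod_piece n x"
    then obtain z where "z \<in> cod_piece n x" "t = sqnorm z" by blast
    then show "(\<Sum>i<k. (embed x i)\<^sup>2) \<le> t"
      using K N that x cod_piece_subset[OF x, of n] by blast
  qed
  then show ?thesis
    by (intro LIMSEQ_le_const[OF Inf_sqnorm_limit[OF x]]) blast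
qed

lemma embed_in_erdos_c:
  assumes x: "x \<in> topspace X"
  shows "embed x \<in> erdos_c"
proof (rule erdos_cI[OF _ embed_values])
  show "embed x \<in> l2"
    unfolding l2_def using summableI_nonneg_bounded[OF _ embed_partial_sqnorm[OF x]] by simp
qed

text \<open>Cylinders are closed under coordinatewise limits: any point of a late piece lies in this
  one and agrees with \<open>embed x\<close> to the depth on which membership depends.\<close>

lemma embed_in_cod_piece:
  assumes x: "x \<in> topspace X"
  shows "embed x \<in> cod_piece n x"
proof -
  have "cylinder (cod_piece n x)" using R_clopen piece[OF x] by blast
  then obtain k where k: "\<forall>y\<in>erdos_c. \<forall>z\<in>erdos_c. agree k y z \<longrightarrow> (y \<in> cod_piece n x \<longleftrightarrow> z \<in> cod_piece n x)"
    unfolding cylinder_def by blast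
  obtain N where N: "\<forall>n\<ge>N. \<forall>x\<in>topspace X. \<forall>z\<in>cod_piece n x. agree k (embed x) z"
    using cod_piece_agree by blast
  obtain z where z: "z \<in> cod_piece (max n N) x" using cod_piece_subset[OF x] by blast
  then have "agree k (embed x) z" using N[rule_format, of "max n N" x z] x by simp
  moreover have "z \<in> cod_piece n x" using z piece_mono(2)[OF x, of n "max n N"] by auto
  moreover have "z \<in> erdos_c" using z cod_piece_subset[OF x] by blast
  ultimately show ?thesis using k embed_in_erdos_c[OF x] by blast
qed

text \<open>The partial sums give one inequality. For the other, \<open>embed x\<close> lies in
  every piece, so its squared norm is at least each infimum, hence at least their limit.\<close>

lemma sqnorm_embed:
  assumes x: "x \<in> topspace X"
  shows "sqnorm (embed x) = f x - u x"
proof (rule antisym)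
  have "summable (\<lambda>i. (embed x i)\<^sup>2)" using erdos_c_l2[OF embed_in_erdos_c[OF x]] by (simp add: l2_def)
  then show "sqnorm (embed x) \<le> f x - u x"
    using embed_partial_sqnorm[OF x] by (intro suminf_le_const)
  have "Inf (sqnorm ` cod_piece n x) \<le> sqnorm (embed x)" for n
    using embed_in_cod_piece[OF x] bdd_below_sqnorm[OF x] by (intro cInf_lower) auto
  then show "f x - u x \<le> sqnorm (embed x)"
    by (intro LIMSEQ_le_const2[OF Inf_sqnorm_limit[OF x]]) blast
qed

end

section \<open>Continuity, openness, density and unboundedness of the embedding\<close>

context matched_pieces
begin

text \<open>A piece of late stage controls finitely many tests and the variation of
  \<open>u\<close>; continuity of \<open>f\<close> then bounds the squared norm \<open>f - u\<close>
  from above. By \<open>agree_imp_close\<close> the two together give closeness in norm.\<close>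

lemma embed_continuous: "continuous_map X l2_topology embed"
  unfolding mtopology_l2[symmetric] l2.continuous_map_to_metric
proof (intro ballI allI impI)
  fix x and e :: real
  assume x: "x \<in> topspace X" and "0 < e"
  obtain k where k: "\<forall>y\<in>erdos_c. agree k (embed x) y \<and> sqnorm y < sqnorm (embed x) + 1 / real (Suc k)
      \<longrightarrow> l2_dist (embed x) y < e"
    using agree_imp_close[OF embed_in_erdos_c[OF x] \<open>0 < e\<close>] by blast
  define c where "c = 1 / real (Suc k)"
  have "c > 0" by (simp add: c_def)
  obtain N where N: "\<forall>n\<ge>N. \<forall>x\<in>topspace X. \<forall>z\<in>cod_piece n x. agree k (embed x) z"
    using cod_piece_agree by blast
  obtain n where n: "n \<ge> N" "4 * (1/2)^n < c / 2"
    using small_power[of "c / 2" N 4] \<open>c > 0\<close> by auto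
  define U where "U = dom_piece n x \<inter> {y \<in> topspace X. f y < f x + c / 2}"
  have "openin X (dom_piece n x)"
    using R_clopen[of "piece n x" n] piece[OF x] by (simp add: clopenin_def)
  then have "openin X U"
    using f_continuous unfolding U_def by (intro openin_Int) (simp_all add: continuous_map_upper_lower_semicontinuous_lt)
  moreover have "x \<in> U" using piece[OF x] x \<open>c > 0\<close> by (simp add: U_def)
  moreover have "embed y \<in> l2.mball (embed x) e" if y: "y \<in> U" for y
  proof -
    have yX: "y \<in> topspace X" and yd: "y \<in> dom_piece n x" and fy: "f y < f x + c / 2"
      using y by (auto simp: U_def)
    have "embed y \<in> cod_piece n x"
      using embed_in_cod_piece[OF yX, of n] dom_piece_eq[OF x yd] by simp
    then have "agree k (embed x) (embed y)" using N n(1) x by blast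
    moreover have "sqnorm (embed y) < sqnorm (embed x) + c"
      using u_close[OF x yd] n(2) fy sqnorm_embed[OF x] sqnorm_embed[OF yX] by linarith
    ultimately have "l2_dist (embed x) (embed y) < e"
      using k embed_in_erdos_c[OF yX] by (simp add: c_def)
    then show ?thesis
      using erdos_c_l2[OF embed_in_erdos_c[OF x]] erdos_c_l2[OF embed_in_erdos_c[OF yX]]
      by (simp add: l2_dist_nonneg)
  qed
  ultimately show "\<exists>U. openin X U \<and> x \<in> U \<and> (\<forall>y\<in>U. embed y \<in> l2.mball (embed x) e)"
    by blast
qed

text \<open>Closeness in norm forces agreement, hence membership in the same Erdos-side piece; since
  these pieces are disjoint, \<open>y\<close> lies in the piece of \<open>x\<close> and so in
  \<open>A i\<close>. The value \<open>f y\<close> is \<open>sqnorm (embed y)\<close> plus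
  \<open>u y\<close>, and neither term can rise much, so \<open>f_base\<close> applies.\<close>

lemma embed_inverse_continuous:
  assumes U: "openin X U" and "x \<in> U"
  shows "\<exists>e>0. \<forall>y\<in>topspace X. l2_dist (embed x) (embed y) < e \<longrightarrow> y \<in> U"
proof -
  have x: "x \<in> topspace X" using assms openin_subset by blast
  obtain i \<delta> where i: "x \<in> A i" "\<delta> > 0" "\<forall>y\<in>A i. f y < f x + \<delta> \<longrightarrow> y \<in> U"
    using f_base[OF assms] by blast
  obtain n where n: "n \<ge> Suc i" "4 * (1/2)^n < \<delta> / 2"
    using small_power[of "\<delta> / 2" "Suc i" 4] i(2) by auto
  have "cylinder (cod_piece n x)" using R_clopen piece[OF x] by blast
  then obtain k where k: "\<forall>y\<in>erdos_c. \<forall>z\<in>erdos_c. agree k y z \<longrightarrow> (y \<in> cod_piece n x \<longleftrightarrow> z \<in> cod_piece n x)"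
    unfolding cylinder_def by blast
  obtain d1 where d1: "d1 > 0" "\<forall>y\<in>erdos_c. \<forall>z\<in>erdos_c. l2_dist y z < d1 \<longrightarrow> agree k y z"
    using close_imp_agree by blast
  obtain d2 where d2: "d2 > 0" "\<forall>y\<in>l2. l2_dist (embed x) y < d2 \<longrightarrow> sqnorm y < sqnorm (embed x) + \<delta> / 2"
    using sqnorm_upper_semicontinuous[OF erdos_c_l2[OF embed_in_erdos_c[OF x]], of "\<delta> / 2"] i(2) by auto
  have "y \<in> U" if y: "y \<in> topspace X" "l2_dist (embed x) (embed y) < min d1 d2" for y
  proof -
    have "agree k (embed x) (embed y)"
      using d1(2) y(2) embed_in_erdos_c[OF x] embed_in_erdos_c[OF y(1)] by simp
    then have "embed y \<in> cod_piece n x"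
      using k embed_in_cod_piece[OF x] embed_in_erdos_c[OF x] embed_in_erdos_c[OF y(1)] by blast
    then have eq: "piece n y = piece n x"
      using piece[OF x] embed_in_cod_piece[OF y(1)] y(1) by (intro piece_eqI'[of _ _ "embed y"]) auto
    then have yd: "y \<in> dom_piece n x" using piece[OF y(1), of n] by simp
    then have "y \<in> A i" using dom_piece_decided[OF i(1) x, of n] n(1) by auto
    moreover have "sqnorm (embed y) < sqnorm (embed x) + \<delta> / 2"
      using d2(2) y(2) erdos_c_l2[OF embed_in_erdos_c[OF y(1)]] by simp
    then have "f y < f x + \<delta>"
      using u_close[OF x yd] n(2) sqnorm_embed[OF x] sqnorm_embed[OF y(1)] by linarith
    ultimately show ?thesis using i(3) by blast
  qed
  then show ?thesis using d1(1) d2(1) by (intro exI[of _ "min d1 d2"]) auto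
qed

lemma embedding_map_embed:
  assumes "t1_space X"
  shows "embedding_map X erdos_c_topology embed"
proof -
  have inj: "inj_on embed (topspace X)"
  proof (rule inj_onI, rule ccontr)
    fix x y assume xy: "x \<in> topspace X" "y \<in> topspace X" "embed x = embed y" "x \<noteq> y"
    have "openin X (topspace X - {y})"
      using assms xy(2) by (simp add: closedin_t1_singleton openin_diff)
    then obtain e where "e > 0" "\<forall>z\<in>topspace X. l2_dist (embed x) (embed z) < e \<longrightarrow> z \<in> topspace X - {y}"
      using embed_inverse_continuous[of "topspace X - {y}" x] xy by blast
    moreover have "l2_dist (embed x) (embed y) = 0" using xy(3) by (simp add: l2_dist_def l2_norm_def)
    ultimately show False using xy(2) by auto
  qed
  have "open_map X (subtopology l2_topology (embed ` topspace X)) embed"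
    unfolding open_map_def
  proof (intro allI impI)
    fix U assume U: "openin X U"
    then have UX: "U \<subseteq> topspace X" by (rule openin_subset)
    obtain e where e: "\<forall>x\<in>U. e x > 0 \<and> (\<forall>y\<in>topspace X. l2_dist (embed x) (embed y) < e x \<longrightarrow> y \<in> U)"
      using embed_inverse_continuous[OF U] by metis
    define W where "W = (\<Union>x\<in>U. l2.mball (embed x) (e x))"
    have "openin l2_topology W"
      unfolding W_def mtopology_l2[symmetric] by blast
    moreover have "embed ` U = W \<inter> embed ` topspace X"
    proof
      show "embed ` U \<subseteq> W \<inter> embed ` topspace X"
      proof
        fix z assume "z \<in> embed ` U"
        then obtain x where x: "x \<in> U" "z = embed x" by blast
        then have "z \<in> l2.mball (embed x) (e x)"
          using e UX erdos_c_l2[OF embed_in_erdos_c[of x]] l2.centre_in_mball_iff by blast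
        then show "z \<in> W \<inter> embed ` topspace X" using x UX unfolding W_def by blast
      qed
      show "W \<inter> embed ` topspace X \<subseteq> embed ` U"
      proof
        fix z assume "z \<in> W \<inter> embed ` topspace X"
        then obtain x y where "x \<in> U" "z \<in> l2.mball (embed x) (e x)" "y \<in> topspace X" "z = embed y"
          unfolding W_def by blast
        then have "l2_dist (embed x) (embed y) < e x" by (simp add: abs_less_iff)
        then have "y \<in> U" using e \<open>x \<in> U\<close> \<open>y \<in> topspace X\<close> by blast
        then show "z \<in> embed ` U" using \<open>z = embed y\<close> by blast
      qed
    qed
    ultimately show "openin (subtopology l2_topology (embed ` topspace X)) (embed ` U)"
      unfolding openin_subtopology by blast
  qed
  moreover have "embed ` topspace X \<subseteq> l2"
    using erdos_c_l2 embed_in_erdos_c by blast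
  ultimately have "embedding_map X l2_topology embed"
    unfolding embedding_map_def using inj embed_continuous
    by (intro bijective_open_imp_homeomorphic_map) (auto simp: continuous_map_in_subtopology)
  then show ?thesis
    unfolding erdos_c_topology_def embedding_map_in_subtopology using embed_in_erdos_c by blast
qed

text \<open>Density in norm comes from matching infima, not merely from the pieces being non-empty.
  In the partner of the piece that contains \<open>y\<close>, a point with nearly minimal
  \<open>f\<close> is sent to a point whose squared norm is at most slightly above the infimum on
  the piece of \<open>y\<close>, hence not much above \<open>sqnorm y\<close>; it also passes the
  same tests as \<open>y\<close>, so \<open>agree_imp_close\<close> applies.\<close>

lemma embed_dense: "erdos_c_topology closure_of (embed ` topspace X) = topspace erdos_c_topology"
proof (rule equalityI[OF closure_of_subset_topspace], rule subsetI)
  fix y assume "y \<in> topspace erdos_c_topology"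
  then have y: "y \<in> erdos_c" by simp
  have "\<exists>z\<in>embed ` topspace X. z \<in> W" if W: "y \<in> W" "openin erdos_c_topology W" for W
  proof -
    obtain W' where W': "l2_open W'" "W = W' \<inter> erdos_c"
      using W(2) unfolding erdos_c_topology_def openin_subtopology openin_l2_topology by blast
    then obtain e where e: "e > 0" "\<forall>z\<in>l2. l2_dist y z < e \<longrightarrow> z \<in> W'"
      using W(1) unfolding l2_open_def by blast
    obtain k where k: "\<forall>z\<in>erdos_c. agree k y z \<and> sqnorm z < sqnorm y + 1 / real (Suc k) \<longrightarrow> l2_dist y z < e"
      using agree_imp_close[OF y e(1)] by blast
    define c where "c = 1 / real (Suc k)"
    have "c > 0" by (simp add: c_def)
    obtain N where N: "\<forall>n\<ge>N. \<forall>x\<in>topspace X. \<forall>z\<in>cod_piece n x. agree k (embed x) z"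
      using cod_piece_agree by blast
    obtain n where n: "n \<ge> N" "2 * (1/2)^n < c / 2"
      using small_power[of "c / 2" N 2] \<open>c > 0\<close> by auto
    have "(\<Union>r\<in>R n. snd r) = erdos_c" using R_matching[of n] by (simp add: matching_def)
    then obtain r where r: "r \<in> R n" "y \<in> snd r" using y by blast
    have rp: "fst r \<noteq> {}" "fst r \<subseteq> topspace X" using matching_piece[OF R_matching r(1)] by blast+
    obtain x where x: "x \<in> fst r" "f x < Inf (f ` fst r) + c / 2"
      using cInf_lessD[of "f ` fst r" "Inf (f ` fst r) + c / 2"] rp(1) \<open>c > 0\<close> by auto
    have xX: "x \<in> topspace X" using x rp by blast
    have px: "piece n x = r" using r(1) x(1) by (rule piece_eqI)
    have "agree k (embed x) y" using N[rule_format, of n x y] n(1) xX r(2) px by simp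
    then have "agree k y (embed x)" by (rule agree_sym)
    moreover have "sqnorm (embed x) < sqnorm y + c"
    proof -
      have "Inf (sqnorm ` snd r) \<le> sqnorm y"
        using bdd_below_sqnorm[OF xX, of n] r(2) px by (intro cInf_lower) auto
      then show ?thesis
        using x(2) u_gap[OF xX, of n] n(2) sqnorm_embed[OF xX] unfolding px defect_def by linarith
    qed
    ultimately have "l2_dist y (embed x) < e"
      using k embed_in_erdos_c[OF xX] by (simp add: c_def)
    then have "embed x \<in> W"
      using e(2) embed_in_erdos_c[OF xX] erdos_c_l2 W'(2) by blast
    then show ?thesis using xX by blast
  qed
  then show "y \<in> erdos_c_topology closure_of (embed ` topspace X)"
    using y by (auto simp: in_closure_of)
qed

lemma embed_unbounded:
  assumes "clopenin X C" and "C \<noteq> {}"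
  shows "\<exists>x\<in>C. t < sqnorm (embed x)"
proof -
  define g where "g = defect f sqnorm (topspace X, erdos_c)"
  \<comment> \<open>\<open>u\<close> exceeds the initial defect \<open>g\<close> by at most 2, the
    sum of all the errors.\<close>
  obtain x where x: "x \<in> C" "t + g + 2 < f x" using f_unbounded[OF assms] by blast
  have "x \<in> topspace X" using assms(1) x(1) openin_subset[of X C] by (auto simp: clopenin_def)
  moreover have "piece 0 x = (topspace X, erdos_c)"
    using \<open>x \<in> topspace X\<close> R_0 by (intro piece_eqI) simp_all
  ultimately have "u x \<le> g + 2" using u_gap[of x 0] by (simp add: g_def)
  then have "t < sqnorm (embed x)" using x(2) sqnorm_embed[OF \<open>x \<in> topspace X\<close>] by linarith
  then show ?thesis using x(1) by blast
qed

end

section \<open>The point at infinity and the final assembly\<close>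

lemma istopology_l2inf_open: "istopology l2inf_open"
  unfolding istopology_def
proof (intro conjI allI impI)
  fix S T assume S: "l2inf_open S" and T: "l2inf_open T"
  have "l2_open ({x. Some x \<in> S} \<inter> {x. Some x \<in> T})"
    using S T istopology_l2_open unfolding istopology_def l2inf_open_def by blast
  moreover have "{x. Some x \<in> S} \<inter> {x. Some x \<in> T} = {x. Some x \<in> S \<inter> T}" by blast
  moreover have "\<exists>r. \<forall>x\<in>l2. r < l2_norm x \<longrightarrow> Some x \<in> S \<inter> T" if "None \<in> S \<inter> T"
  proof -
    obtain r where r: "\<forall>x\<in>l2. r < l2_norm x \<longrightarrow> Some x \<in> S" using S \<open>None \<in> S \<inter> T\<close> unfolding l2inf_open_def by blast
    obtain r' where r': "\<forall>x\<in>l2. r' < l2_norm x \<longrightarrow> Some x \<in> T" using T \<open>None \<in> S \<inter> T\<close> unfolding l2inf_open_def by blast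
    show ?thesis using r r' by (intro exI[of _ "max r r'"]) simp
  qed
  moreover have "S \<inter> T \<subseteq> Some ` l2 \<union> {None}" using S unfolding l2inf_open_def by blast
  ultimately show "l2inf_open (S \<inter> T)" by (simp add: l2inf_open_def)
next
  fix K assume K: "\<forall>S\<in>K. l2inf_open S"
  have "\<forall>S\<in>(\<lambda>S. {x. Some x \<in> S}) ` K. l2_open S"
    using K by (simp add: l2inf_open_def)
  then have "l2_open (\<Union>S\<in>K. {x. Some x \<in> S})"
    using istopology_l2_open by (simp add: istopology_def)
  moreover have "(\<Union>S\<in>K. {x. Some x \<in> S}) = {x. Some x \<in> \<Union>K}" by blast
  moreover have "\<exists>r. \<forall>x\<in>l2. r < l2_norm x \<longrightarrow> Some x \<in> \<Union>K" if "None \<in> \<Union>K"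
    using that K unfolding l2inf_open_def by (meson Union_iff)
  moreover have "\<Union>K \<subseteq> Some ` l2 \<union> {None}" using K unfolding l2inf_open_def by blast
  ultimately show "l2inf_open (\<Union>K)" by (simp add: l2inf_open_def)
qed

lemma openin_l2inf_topology: "openin l2inf_topology = l2inf_open"
  unfolding l2inf_topology_def by (rule topology_inverse'[OF istopology_l2inf_open])

lemma topspace_l2inf_topology: "topspace l2inf_topology = Some ` l2 \<union> {None}"
proof -
  have "openin l2_topology l2" using openin_topspace[of l2_topology] by simp
  moreover have "{x. Some x \<in> Some ` l2 \<union> {None}} = l2" by auto
  ultimately have "l2inf_open (Some ` l2 \<union> {None})"
    by (simp add: l2inf_open_def openin_l2_topology)
  moreover have "U \<subseteq> Some ` l2 \<union> {None}" if "l2inf_open U" for U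
    using that by (simp add: l2inf_open_def)
  ultimately show ?thesis
    unfolding topspace_def openin_l2inf_topology by blast
qed

text \<open>In a separation, the side without infinity has a non-empty clopen preimage. The other
  side contains every point of large norm, so the norm would be bounded on that preimage.\<close>

lemma connectedin_insert_infinity:
  assumes cont: "continuous_map X l2_topology \<alpha>"
    and unbounded: "\<And>C t. clopenin X C \<Longrightarrow> C \<noteq> {} \<Longrightarrow> \<exists>x\<in>C. t < l2_norm (\<alpha> x)"
  shows "connectedin l2inf_topology (Some ` \<alpha> ` topspace X \<union> {None})"
proof -
  let ?S = "Some ` \<alpha> ` topspace X \<union> {None}"
  have im: "\<alpha> x \<in> l2" if "x \<in> topspace X" for x
    using cont that by (auto simp: continuous_map_def)
  have separated: False
    if U: "l2inf_open U" and W: "l2inf_open W" and cover: "?S \<subseteq> U \<union> W" and disj: "U \<inter> W \<inter> ?S = {}"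
      and ne: "W \<inter> ?S \<noteq> {}" and "None \<in> U" for U W
  proof -
    have "None \<notin> W" using disj \<open>None \<in> U\<close> by blast
    define C where "C = {x \<in> topspace X. \<alpha> x \<in> {z. Some z \<in> W}}"
    define D where "D = {x \<in> topspace X. \<alpha> x \<in> {z. Some z \<in> U}}"
    have "openin X C" "openin X D"
      unfolding C_def D_def using U W
      by (intro openin_continuous_map_preimage[OF cont], simp add: openin_l2_topology l2inf_open_def)+
    moreover have "C = topspace X - D"
      using cover disj unfolding C_def D_def by blast
    ultimately have "clopenin X C" unfolding clopenin_def by blast
    moreover have "C \<noteq> {}" using ne \<open>None \<notin> W\<close> unfolding C_def by blast
    moreover obtain r where r: "\<forall>z\<in>l2. r < l2_norm z \<longrightarrow> Some z \<in> U"
      using U \<open>None \<in> U\<close> unfolding l2inf_open_def by blast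
    ultimately obtain x where x: "x \<in> C" "r < l2_norm (\<alpha> x)" using unbounded by blast
    then have "x \<in> topspace X" by (simp add: C_def)
    then have "x \<in> D" using r im x by (simp add: D_def)
    then show False using x \<open>C = topspace X - D\<close> by blast
  qed
  have "?S \<subseteq> topspace l2inf_topology"
    using im by (auto simp: topspace_l2inf_topology)
  moreover have "\<not> (\<exists>U W. l2inf_open U \<and> l2inf_open W \<and> ?S \<subseteq> U \<union> W \<and> U \<inter> W \<inter> ?S = {} \<and>
    U \<inter> ?S \<noteq> {} \<and> W \<inter> ?S \<noteq> {})"
  proof (intro notI, elim exE conjE)
    fix U W
    assume a: "l2inf_open U" "l2inf_open W" "?S \<subseteq> U \<union> W" "U \<inter> W \<inter> ?S = {}" "U \<inter> ?S \<noteq> {}" "W \<inter> ?S \<noteq> {}"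
    have "None \<in> U \<or> None \<in> W" using a(3) by blast
    then show False
    proof
      assume "None \<in> U"
      then show False by (rule separated[OF a(1,2,3,4,6)])
    next
      assume n: "None \<in> W"
      have "?S \<subseteq> W \<union> U" "W \<inter> U \<inter> ?S = {}" using a(3,4) by (simp_all add: Un_commute Int_commute)
      then show False using separated[OF a(2,1) _ _ a(5) n] by blast
    qed
  qed
  ultimately show ?thesis
    unfolding connectedin openin_l2inf_topology by blast
qed

theorem theorem3p1:
  fixes E :: "'a topology"
  assumes "metrizable_space E" and "separable_space E"
    and "topspace E \<noteq> {}"
    and "cohesive E" and "almost_zero_dimensional E"
  shows "\<exists>\<alpha>. embedding_map E erdos_c_topology \<alpha> \<and>
           erdos_c_topology closure_of (\<alpha> ` topspace E) = topspace erdos_c_topology \<and>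
           connectedin l2inf_topology (Some ` \<alpha> ` topspace E \<union> {None})"
proof -
  have "second_countable E"
    using assms(1,2) by (rule metrizable_separable_imp_second_countable)
  then obtain T Z where "witness_topology E T Z"
    using almost_zero_dimensional_witness assms(5) by blast
  then interpret witness_topology E T Z .
  obtain f where f: "continuous_map E euclideanreal f" "lsc f" "\<And>x. x \<in> topspace E \<Longrightarrow> 0 \<le> f x"
    "\<And>C t. clopenin E C \<Longrightarrow> C \<noteq> {} \<Longrightarrow> \<exists>x\<in>C. t < f x"
    "\<And>U x. openin E U \<Longrightarrow> x \<in> U \<Longrightarrow> \<exists>A\<in>Z. \<exists>\<delta>>0. x \<in> A \<and> (\<forall>y\<in>A. f y < f x + \<delta> \<longrightarrow> y \<in> U)"
    using unbounded_potential[OF assms(4,3)] by blast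
  obtain x0 where x0: "x0 \<in> topspace E" using assms(3) by blast
  then have "Z \<noteq> {}" using f(5)[OF openin_topspace] by blast
  define A where "A = from_nat_into Z"
  have A: "A n \<in> Z" for n
    unfolding A_def using \<open>Z \<noteq> {}\<close> by (rule from_nat_into)
  have A_surj: "\<exists>n. A n = S" if "S \<in> Z" for S
    unfolding A_def using from_nat_into_surj[OF Z_countable that] .
  \<comment> \<open>The algebra consists of all clopen sets, since \<open>Z\<close> is given as a
    base and its closure under differences is not assumed; the members of \<open>Z\<close> enter as
    the sets \<open>A n\<close> to be decided.\<close>
  have X: "splitting_algebra (topspace E) {C. clopenin E C} f"
    unfolding splitting_algebra_def
  proof (intro conjI)
    show "splitting {C. clopenin E C} f" using f(1-4) by (rule splitting_clopen)
    show "\<forall>C\<in>{C. clopenin E C}. C \<subseteq> topspace E" using openin_subset by (auto simp: clopenin_def)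
  qed (use f(3) assms(3) clopenin_Int clopenin_Diff in \<open>auto simp: clopenin_def\<close>)
  define B where "B n = (case prod_decode n of (i, m) \<Rightarrow> coordinate_set i m)" for n
  have B: "B n \<in> {Q. cylinder Q}" for n
    using cylinder_coordinate by (simp add: B_def coordinate_set_def split: prod.split)
  have A': "A n \<in> {C. clopenin E C}" for n
    using Z_clopen[OF A] coarser closedin_coarser by (simp add: clopenin_def)
  obtain R where R: "R 0 = {(topspace E, erdos_c)}" "\<And>n. matching (topspace E) erdos_c (R n)"
    "\<And>n. R n \<subseteq> {C. clopenin E C} \<times> {Q. cylinder Q}" "\<And>n. refines f sqnorm ((1/2)^n) (R n) (R (Suc n))"
    "\<And>n. decides (A n) (fst ` R (Suc n))" "\<And>n. decides (B n) (snd ` R (Suc n))"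
    using matching_sequence[OF X splitting_algebra_erdos_c, of A B, OF A' B] by blast
  interpret matched_pieces E f A R
  proof
    show "\<exists>n. x \<in> A n \<and> (\<forall>y\<in>A n. c < f y)" if x: "x \<in> topspace E" "c < f x" for x c
    proof -
      have "openin T {y \<in> topspace E. c < f y}" "x \<in> {y \<in> topspace E. c < f y}"
        using f(2) x by (auto simp: lsc_def)
      then obtain S where "S \<in> Z" "x \<in> S" "S \<subseteq> {y \<in> topspace E. c < f y}" using Z_base by meson
      moreover obtain n where "A n = S" using A_surj[OF \<open>S \<in> Z\<close>] by blast
      ultimately show ?thesis by (intro exI[of _ n]) auto
    qed
    show "\<exists>n. \<exists>\<delta>>0. x \<in> A n \<and> (\<forall>y\<in>A n. f y < f x + \<delta> \<longrightarrow> y \<in> U)" if "openin E U" "x \<in> U" for U x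
      using f(5)[OF that] A_surj by metis
    show "clopenin E (fst r) \<and> cylinder (snd r)" if "r \<in> R n" for n r
      using R(3)[of n] that by auto
    show "decides (coordinate_set i m) (snd ` R (Suc (prod_encode (i, m))))" for i m
      using R(6)[of "prod_encode (i, m)"] by (simp add: B_def)
  qed (use f R in auto)
  have "t1_space E"
    using assms(1) by (simp add: metrizable_imp_t1_space)
  then have "embedding_map E erdos_c_topology embed" by (rule embedding_map_embed)
  moreover have "connectedin l2inf_topology (Some ` embed ` topspace E \<union> {None})"
  proof (rule connectedin_insert_infinity[OF embed_continuous])
    show "\<exists>x\<in>C. t < l2_norm (embed x)" if C: "clopenin E C" "C \<noteq> {}" for C t
    proof -
      obtain x where x: "x \<in> C" "t\<^sup>2 < sqnorm (embed x)" using embed_unbounded[OF C] by blast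
      then have "t < l2_norm (embed x)"
        unfolding l2_norm_def by (intro real_less_rsqrt)
      then show ?thesis using x(1) by blast
    qed
  qed
  ultimately show ?thesis
    using embed_dense by (intro exI[of _ embed] conjI)
qed

end
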